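(* Let $d\in\mathbb{N}$, let $\boldsymbol{p}\in(0,1)^d$ satisfy $\|\boldsymbol{p}\|_1<1$, put $q=1-\|\boldsymbol{p}\|_1$, and let $\eta\in(0,1)$. For $N\in\mathbb{N}$ define $$B_{N,\boldsymbol{p}}(\eta)=\Big\{\boldsymbol{k}\in\mathbb{N}_0^d:\ \Big|\frac{\delta_{i,k_i}}{\sqrt{N}\,p_i}\Big|\le\eta N^{-1/3}\ \text{for all } i\in\{1,\dots,d\},\ \text{and}\ \Big|\sum_{i=1}^d\frac{\delta_{i,k_i}}{\sqrt{N}\,q}\Big|\le\eta N^{-1/3}\Big\},$$ where $\delta_{i,b}=(b-Np_i)/\sqrt{N}$ for $b\in\mathbb{R}$, and $\boldsymbol{\delta}_{\boldsymbol{k}}=(\delta_{1,k_1},\dots,\delta_{d,k_d})^\top$. Then, uniformly for $\boldsymbol{k}\in B_{N,\boldsymbol{p}}(\eta)$, as $N\to\infty$, $$\begin{aligned} \frac{p_N(\boldsymbol{k})}{N^{-d/2}\phi_\Sigma(\boldsymbol{\delta}_{\boldsymbol{k}})} &=1+N^{-1/2}\Big\{-\tfrac12\sum_{i=1}^d\delta_{i,k_i}\Big(\frac1{p_i}-\frac1q\Big)+\tfrac16\sum_{i,j,\ell=1}^d\delta_{i,k_i}\delta_{j,k_j}\delta_{\ell,k_\ell}\Big(\frac{1}{p_i^2}\mathbf{1}_{\{i=j=\ell\}}-\frac1{q^2}\Big)\Big\}\\ &\quad+N^{-1}\Big\{-\tfrac1{12}\sum_{i,j,\ell,m=1}^d\delta_{i,k_i}\delta_{j,k_j}\delta_{\ell,k_\ell}\delta_{m,k_m}\Big(\frac1{p_i^2}\mathbf{1}_{\{i=j=\ell\}}-\frac1{q^2}\Big)\Big(\frac1{p_m}-\frac1q\Big)\\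 &\qquad-\tfrac1{12}\sum_{i,j,\ell,m=1}^d\delta_{i,k_i}\delta_{j,k_j}\delta_{\ell,k_\ell}\delta_{m,k_m}\Big(\frac1{p_i^3}\mathbf{1}_{\{i=j=\ell=m\}}+\frac1{q^3}\Big)\\ &\qquad+\tfrac1{72}\Big(\sum_{i,j,\ell=1}^d\delta_{i,k_i}\delta_{j,k_j}\delta_{\ell,k_\ell}\Big(\frac1{p_i^2}\mathbf{1}_{\{i=j=\ell\}}-\frac1{q^2}\Big)\Big)^2\\ &\qquad+\tfrac18\sum_{i,j=1}^d\delta_{i,k_i}\delta_{j,k_j}\Big(\frac3{p_i^2}\mathbf{1}_{\{i=j\}}+\frac2{p_ip_j}\mathbf{1}_{\{i<j\}}-\frac2{p_iq}+\frac3{q^2}\Big)\\ &\qquad+\tfrac1{12}\Big(1-\sum_{i=1}^dp_i^{-1}-q^{-1}\Big)\Big\} +\mathcal{O}_{d,\boldsymbol{p},\eta}\Big(\frac{(1+\|\boldsymbol{\delta}_{\boldsymbol{k}}\|_1)^9}{N^{3/2}}\Big). \end{aligned}$$ This expansion is equivalent to the following symmetrized version: with $\delta_{d+1,k_{d+1}}=-\sum_{i=1}^d\delta_{i,k_i}$ and $p_{d+1}=q$, uniformly for $\boldsymbol{k}\in B_{N,\boldsymbol{p}}(\eta)$, as $N\to\infty$, $$\begin{aligned} \frac{p_N(\boldsymbol{k})}{N^{-d/2}\phi_\Sigma(\boldsymbol{\delta}_{\boldsymbol{k}})} &=1+N^{-1/2}\Big\{-\tfrac12\sum_{i=1}^{d+1}\frac{\delta_{i,k_i}}{p_i}+\tfrac16\sum_{i=1}^{d+1}\delta_{i,k_i}\Big(\frac{\delta_{i,k_i}}{p_i}\Big)^2\Big\}\\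 &\quad+N^{-1}\Big\{\tfrac12\Big(-\tfrac12\sum_{i=1}^{d+1}\frac{\delta_{i,k_i}}{p_i}+\tfrac16\sum_{i=1}^{d+1}\delta_{i,k_i}\Big(\frac{\delta_{i,k_i}}{p_i}\Big)^2\Big)^2+\tfrac14\sum_{i=1}^{d+1}\Big(\frac{\delta_{i,k_i}}{p_i}\Big)^2\\ &\qquad-\tfrac1{12}\sum_{i=1}^{d+1}\delta_{i,k_i}\Big(\frac{\delta_{i,k_i}}{p_i}\Big)^3+\tfrac1{12}\Big(1-\sum_{i=1}^{d+1}p_i^{-1}\Big)\Big\} +\mathcal{O}_{d,\boldsymbol{p},\eta}\Big(\frac{(1+\|\boldsymbol{\delta}_{\boldsymbol{k}}\|_1)^9}{N^{3/2}}\Big). \end{aligned}$$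
   Context: $\|\boldsymbol{x}\|_1=\sum_{i=1}^d|x_i|$. For $\boldsymbol{k}\in\mathbb{N}_0^d$ with $\|\boldsymbol{k}\|_1\le N$, the $\mathrm{Multinomial}(N,\boldsymbol{p})$ probability mass function is $$p_N(\boldsymbol{k})=\frac{N!}{(N-\|\boldsymbol{k}\|_1)!\prod_{i=1}^dk_i!}\,q^{N-\|\boldsymbol{k}\|_1}\prod_{i=1}^dp_i^{k_i}.$$ Let $\Sigma=\mathrm{diag}(\boldsymbol{p})-\boldsymbol{p}\boldsymbol{p}^\top$ (so $\det\Sigma=p_1\cdots p_d\,q$) and $$\phi_\Sigma(\boldsymbol{x})=\frac{1}{\sqrt{(2\pi)^dp_1p_2\cdots p_d\,q}}\exp\Big(-\tfrac12\boldsymbol{x}^\top\Sigma^{-1}\boldsymbol{x}\Big),\quad\boldsymbol{x}\in\mathbb{R}^d.$$ The notation $u=\mathcal{O}(v)$ means $\limsup_{N\to\infty}|u/v|<C$ for a universal constant $C\in(0,\infty)$; subscripts (as in $\mathcal{O}_{d,\boldsymbol{p},\eta}$) indicate the parameters on which $C$ may depend. "Uniformly for $\boldsymbol{k}\in B_{N,\boldsymbol{p}}(\eta)$" means that the limsup bound holds for the supremum of $|u/v|$ over $\boldsymbol{k}\in B_{N,\boldsymbol{p}}(\eta)$. *)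

theory Defs
  imports "HOL-Analysis.Analysis"
begin

text \<open>
  Vectors are indexed by a type \<open>'d\<close> of class \<open>finite\<close>, so that \<open>d = CARD('d)\<close>. The class
  \<open>linorder\<close> is required only where the condition \<open>i < j\<close> on indices occurs.
\<close>

definition l1_norm :: "real^'d \<Rightarrow> real"
  where "l1_norm x = (\<Sum>i\<in>UNIV. \<bar>x $ i\<bar>)"

definition rest :: "real^'d \<Rightarrow> real"
  where "rest p = 1 - l1_norm p"

definition total :: "nat^'d \<Rightarrow> nat"
  where "total k = (\<Sum>i\<in>UNIV. k $ i)"

definition multinomial_prob :: "nat \<Rightarrow> real^'d \<Rightarrow> nat^'d \<Rightarrow> real"
  where "multinomial_prob N p k =
    (if total k \<le> N
     then fact N / (fact (N - total k) * (\<Prod>i\<in>UNIV. fact (k $ i)))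
            * rest p ^ (N - total k) * (\<Prod>i\<in>UNIV. p $ i ^ (k $ i))
     else 0)"

definition Sigma_mat :: "real^'d \<Rightarrow> real^'d^'d"
  where "Sigma_mat p = (\<chi> i j. (if i = j then p $ i else 0) - p $ i * p $ j)"

definition phi_Sigma :: "real^'d \<Rightarrow> real^'d \<Rightarrow> real"
  where "phi_Sigma p x =
    1 / sqrt ((2 * pi) ^ CARD('d) * (\<Prod>i\<in>UNIV. p $ i) * rest p)
      * exp (- (1/2) * (x \<bullet> (matrix_inv (Sigma_mat p) *v x)))"

definition delta :: "nat \<Rightarrow> real^'d \<Rightarrow> 'd \<Rightarrow> real \<Rightarrow> real"
  where "delta N p i b = (b - real N * p $ i) / sqrt (real N)"

definition delta_vec :: "nat \<Rightarrow> real^'d \<Rightarrow> nat^'d \<Rightarrow> real^'d"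
  where "delta_vec N p k = (\<chi> i. delta N p i (real (k $ i)))"

definition bulk :: "real^'d \<Rightarrow> real \<Rightarrow> nat \<Rightarrow> (nat^'d) set"
  where "bulk p \<eta> N =
    {k. (\<forall>i. \<bar>delta N p i (real (k $ i)) / (sqrt (real N) * p $ i)\<bar> \<le> \<eta> * real N powr (- 1/3))
      \<and> \<bar>\<Sum>i\<in>UNIV. delta N p i (real (k $ i)) / (sqrt (real N) * rest p)\<bar> \<le> \<eta> * real N powr (- 1/3)}"

text \<open>
  \<open>u = O(v)\<close> uniformly over the sets \<open>B N\<close>. Extended reals are used because the supremum over
  \<open>B N\<close> need not be finite a priori; the supremum over an empty set is \<open>-\<infinity>\<close>.
\<close>

definition bigo_uniformly :: "(nat \<Rightarrow> 'k set) \<Rightarrow> (nat \<Rightarrow> 'k \<Rightarrow> real) \<Rightarrow> (nat \<Rightarrow> 'k \<Rightarrow> real) \<Rightarrow> bool"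
  where "bigo_uniformly B u v \<longleftrightarrow>
    (\<exists>C::real. C > 0 \<and> limsup (\<lambda>N. SUP k\<in>B N. ereal \<bar>u N k / v N k\<bar>) < ereal C)"

definition coeff_half :: "real^'d \<Rightarrow> real^'d \<Rightarrow> real"
  where "coeff_half p x =
    - (1/2) * (\<Sum>i\<in>UNIV. x $ i * (1 / p $ i - 1 / rest p))
    + 1/6 * (\<Sum>i\<in>UNIV. \<Sum>j\<in>UNIV. \<Sum>l\<in>UNIV. x $ i * x $ j * x $ l
              * (1 / (p $ i)^2 * of_bool (i = j \<and> j = l) - 1 / (rest p)^2))"

definition coeff_one :: "real^('d::{finite,linorder}) \<Rightarrow> real^('d::{finite,linorder}) \<Rightarrow> real"
  where "coeff_one p x =
    - (1/12) * (\<Sum>i\<in>UNIV. \<Sum>j\<in>UNIV. \<Sum>l\<in>UNIV. \<Sum>m\<in>UNIV. x $ i * x $ j * x $ l * x $ m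
              * (1 / (p $ i)^2 * of_bool (i = j \<and> j = l) - 1 / (rest p)^2)
              * (1 / p $ m - 1 / rest p))
    - 1/12 * (\<Sum>i\<in>UNIV. \<Sum>j\<in>UNIV. \<Sum>l\<in>UNIV. \<Sum>m\<in>UNIV. x $ i * x $ j * x $ l * x $ m
              * (1 / (p $ i)^3 * of_bool (i = j \<and> j = l \<and> l = m) + 1 / (rest p)^3))
    + 1/72 * (\<Sum>i\<in>UNIV. \<Sum>j\<in>UNIV. \<Sum>l\<in>UNIV. x $ i * x $ j * x $ l
              * (1 / (p $ i)^2 * of_bool (i = j \<and> j = l) - 1 / (rest p)^2))^2
    + 1/8 * (\<Sum>i\<in>UNIV. \<Sum>j\<in>UNIV. x $ i * x $ j
              * (3 / (p $ i)^2 * of_bool (i = j) + 2 / (p $ i * p $ j) * of_bool (i < j)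
                 - 2 / (p $ i * rest p) + 3 / (rest p)^2))
    + 1/12 * (1 - (\<Sum>i\<in>UNIV. 1 / p $ i) - 1 / rest p)"

definition expansion :: "nat \<Rightarrow> real^('d::{finite,linorder}) \<Rightarrow> nat^('d::{finite,linorder}) \<Rightarrow> real"
  where "expansion N p k =
    1 + real N powr (- 1/2) * coeff_half p (delta_vec N p k)
      + real N powr (- 1) * coeff_one p (delta_vec N p k)"

text \<open>
  The index set \<open>{1, \<dots>, d+1}\<close> is the type \<open>'d option\<close>, with \<open>None\<close> in the role of \<open>d+1\<close>.
\<close>

definition ext_prob :: "real^'d \<Rightarrow> 'd option \<Rightarrow> real"
  where "ext_prob p i = (case i of None \<Rightarrow> rest p | Some j \<Rightarrow> p $ j)"

definition ext_delta :: "real^'d \<Rightarrow> 'd option \<Rightarrow> real"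
  where "ext_delta x i = (case i of None \<Rightarrow> - (\<Sum>j\<in>UNIV. x $ j) | Some j \<Rightarrow> x $ j)"

definition sym_coeff_half :: "real^'d \<Rightarrow> real^'d \<Rightarrow> real"
  where "sym_coeff_half p x =
    - (1/2) * (\<Sum>i\<in>UNIV. ext_delta x i / ext_prob p i)
    + 1/6 * (\<Sum>i\<in>UNIV. ext_delta x i * (ext_delta x i / ext_prob p i)^2)"

definition sym_coeff_one :: "real^'d \<Rightarrow> real^'d \<Rightarrow> real"
  where "sym_coeff_one p x =
    1/2 * (- (1/2) * (\<Sum>i\<in>UNIV. ext_delta x i / ext_prob p i)
           + 1/6 * (\<Sum>i\<in>UNIV. ext_delta x i * (ext_delta x i / ext_prob p i)^2))^2
    + 1/4 * (\<Sum>i\<in>UNIV. (ext_delta x i / ext_prob p i)^2)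
    - 1/12 * (\<Sum>i\<in>UNIV. ext_delta x i * (ext_delta x i / ext_prob p i)^3)
    + 1/12 * (1 - (\<Sum>i\<in>UNIV. 1 / ext_prob p i))"

definition sym_expansion :: "nat \<Rightarrow> real^'d \<Rightarrow> nat^'d \<Rightarrow> real"
  where "sym_expansion N p k =
    1 + real N powr (- 1/2) * sym_coeff_half p (delta_vec N p k)
      + real N powr (- 1) * sym_coeff_one p (delta_vec N p k)"

end

theory Submission
  imports Defs "HOL-Real_Asymp.Real_Asymp"
begin

text \<open>
  Add the category \<open>None\<close> with probability \<open>rest p\<close> and count \<open>N - total k\<close>. The \<open>d + 1\<close> counts are then
  distributed like independent Poisson counts with means \<open>N * P i\<close>, conditioned on their sum being
  \<open>N\<close>, so the multinomial probability is a product of Poisson probabilities divided by the probability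
  that a Poisson(\<open>N\<close>) variable equals \<open>N\<close>. The quadratic form of the inverse covariance matrix is
  the sum of \<open>x i\<^sup>2 / P i\<close> over all \<open>d + 1\<close> categories (\<open>Sigma_mat_quadratic_form\<close>), so the normal density
  factors in the same way. Consequently the logarithm of the ratio is a sum of one-dimensional terms
  \<open>poisson_log\<close>, less the one for the total count (\<open>multinomial_ratio_eq\<close>), which explains why the expansion is symmetric in all \<open>d + 1\<close>
  categories.

  Each term is expanded by Stirling's formula with the correction \<open>1 / (12 * n)\<close>
  (\<open>stirling_ln_fact\<close>, \<open>poisson_log_expansion\<close>). With \<open>w = 1 + l1_norm x\<close>, the logarithm of the
  ratio becomes \<open>a / sqrt N + b / N\<close> up to an error of order \<open>w ^ 5 / N powr (3/2)\<close>, where \<open>a\<close> is of order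
  \<open>w ^ 3\<close> and \<open>b\<close> of order \<open>w ^ 4\<close>. In the bulk \<open>w ^ 3\<close> is at most a multiple of \<open>sqrt N\<close> (\<open>bulk_bounds\<close>), so
  the logarithm is bounded there, and a second order expansion of the exponential
  (\<open>exp_second_order_error\<close>) gives \<open>1 + a / sqrt N + (a\<^sup>2 / 2 + b) / N\<close> up to \<open>w ^ 9 / N powr (3/2)\<close>. This is the
  symmetrised expansion. The other form is the same polynomial in the deviations: its multiple sums
  collapse to power sums (\<open>expansion_eq_sym\<close>).
\<close>

section \<open>Stirling's formula with the first correction term\<close>

text \<open>
  The remainder of the quartic Taylor polynomial has derivative \<open>t ^ 4 / (1 + t)\<close>, so the
  mean value inequality gives the error directly. The bound on \<open>y\<close> is one-sided so that
  \<open>\<eta> = 0\<close> covers all \<open>y \<ge> 0\<close>, in particular \<open>y = 1 / n\<close> down to \<open>n = 1\<close>.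
\<close>

lemma ln_one_plus_quartic_error:
  fixes y \<eta> :: real
  assumes "0 \<le> \<eta>" "\<eta> < 1" "- \<eta> \<le> y"
  shows "\<bar>ln (1 + y) - (y - y^2/2 + y^3/3 - y^4/4)\<bar> \<le> \<bar>y\<bar>^5 / (1 - \<eta>)"
proof -
  define f where "f t = ln (1 + t) - (t - t^2/2 + t^3/3 - t^4/4)" for t :: real
  define S where "S = closed_segment 0 y"
  have S: "- \<eta> \<le> t" "\<bar>t\<bar> \<le> \<bar>y\<bar>" if "t \<in> S" for t
    using that assms by (auto simp: S_def closed_segment_eq_real_ivl split: if_splits)
  have "norm (f y - f 0) \<le> (\<bar>y\<bar>^4 / (1 - \<eta>)) * norm (y - 0)"
  proof (rule field_differentiable_bound[where S = S and f' = "\<lambda>t. t^4 / (1 + t)"])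
    show "convex S" "y \<in> S" "0 \<in> S" by (auto simp: S_def)
  next
    fix t assume t: "t \<in> S"
    have pos: "1 + t > 0" using S(1)[OF t] assms by linarith
    have "(f has_field_derivative (1 / (1 + t) - (1 - t + t^2 - t^3))) (at t within S)"
      unfolding f_def using pos by (auto intro!: derivative_eq_intros simp: field_simps power2_eq_square power3_eq_cube)
    moreover have "1 / (1 + t) - (1 - t + t^2 - t^3) = t^4 / (1 + t)"
      using pos by (simp add: field_simps) algebra
    ultimately show "(f has_field_derivative t^4 / (1 + t)) (at t within S)" by simp
    have "\<bar>t\<bar>^4 \<le> \<bar>y\<bar>^4" using S(2)[OF t] by (rule power_mono) simp
    moreover have "0 < 1 - \<eta>" "1 - \<eta> \<le> 1 + t" "0 \<le> \<bar>y\<bar>^4" using S(1)[OF t] assms by auto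
    ultimately have "\<bar>t\<bar>^4 / (1 + t) \<le> \<bar>y\<bar>^4 / (1 - \<eta>)" by (intro frac_le)
    thus "norm (t^4 / (1 + t)) \<le> \<bar>y\<bar>^4 / (1 - \<eta>)" using pos by simp
  qed
  also have "\<dots> = \<bar>y\<bar>^5 / (1 - \<eta>)" by (simp add: eval_nat_numeral)
  finally show ?thesis by (simp add: f_def)
qed

definition stirling_rest :: "nat \<Rightarrow> real" where
  "stirling_rest n = ln (fact n) - (real n * ln (real n) - real n + ln (real n) / 2)"

text \<open>
  With \<open>y = 1 / n\<close> the increment of \<open>stirling_rest\<close> is \<open>(1 / y + 1 / 2) * ln (1 + y) - 1\<close>. Its terms of
  orders \<open>y\<^sup>2\<close> and \<open>y ^ 3\<close> agree with those of the increment of \<open>1 / (12 * n)\<close>, so what is left is of order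
  \<open>1 / n ^ 4\<close>. The bound is put in telescoping form so that it can be summed at once.
\<close>

lemma stirling_rest_step:
  fixes n :: nat assumes "n \<ge> 1"
  shows "\<bar>(stirling_rest n - 1 / (12 * real n)) - (stirling_rest (Suc n) - 1 / (12 * real (Suc n)))\<bar>
           \<le> 4 * (1 / (real n)^2 - 1 / (real (Suc n))^2)"
proof -
  define y where "y = 1 / real n"
  have y: "0 < y" "y \<le> 1" "real n = 1 / y" using assms by (auto simp: y_def)
  define e where "e = ln (1 + y) - (y - y^2/2 + y^3/3 - y^4/4)"
  have e: "\<bar>e\<bar> \<le> y^5"
    using ln_one_plus_quartic_error[of 0 y] y by (simp add: e_def)
  have lnS: "ln (real (Suc n)) = ln (real n) + ln (1 + y)"
  proof -
    have "real (Suc n) = real n * (1 + y)" using assms by (simp add: y_def field_simps)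
    thus ?thesis using assms y(1) by (simp add: ln_mult del: of_nat_Suc)
  qed
  have "stirling_rest n - stirling_rest (Suc n) = (real n + 1/2) * ln (1 + y) - 1"
  proof -
    have "ln (fact (Suc n)) = ln (real (Suc n)) + ln (fact n :: real)"
      by (simp add: ln_mult del: of_nat_Suc)
    thus ?thesis unfolding stirling_rest_def lnS by (simp add: field_simps)
  qed
  also have "\<dots> = (1/y + 1/2) * (y - y^2/2 + y^3/3 - y^4/4) - 1 + (1/y + 1/2) * e"
    by (simp add: e_def y(3) algebra_simps)
  also have "(1/y + 1/2) * (y - y^2/2 + y^3/3 - y^4/4) - 1 = y^2/12 - y^3/12 - y^4/8"
    using y by (simp add: field_simps eval_nat_numeral)
  finally have 1: "stirling_rest n - stirling_rest (Suc n)
      = y^2/12 - y^3/12 - y^4/8 + (1/y + 1/2) * e" .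
  have "1 / (12 * real n) - 1 / (12 * real (Suc n)) = y/12 - y / (12 * (1 + y))"
    using y(1) by (simp add: y(3) field_simps)
  also have "\<dots> = y^2/12 - y^3/12 + y^4 / (12 * (1 + y))"
    using y(1) by (simp add: field_simps eval_nat_numeral)
  finally have 2: "1 / (12 * real n) - 1 / (12 * real (Suc n)) = y^2/12 - y^3/12 + y^4 / (12 * (1 + y))" .
  have "\<bar>(1/y + 1/2) * e\<bar> \<le> (1/y + 1/2) * y^5"
    using y e by (simp add: abs_mult mult_left_mono)
  also have "\<dots> = y^4 + y^4 * (y / 2)" using y by (simp add: field_simps eval_nat_numeral)
  also have "\<dots> \<le> y^4 + y^4 * (1/2)" using y by (intro add_left_mono mult_left_mono) auto
  finally have 3: "\<bar>(1/y + 1/2) * e\<bar> \<le> 3/2 * y^4" by simp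
  have 4: "0 \<le> y^4 / (12 * (1 + y))" using y by simp
  have 5: "y^4 / (12 * (1 + y)) \<le> y^4 / 12" using y by (intro divide_left_mono) auto
  have "\<bar>(stirling_rest n - 1 / (12 * real n)) - (stirling_rest (Suc n) - 1 / (12 * real (Suc n)))\<bar> \<le> 2 * y^4"
    using 1 2 3 4 5 zero_le_power[of y 4] y by linarith
  also have "2 * y^4 = 2 / (real n)^4" by (simp add: y_def power_divide)
  also have "\<dots> \<le> 4 * (1 / (real n)^2 - 1 / (real (Suc n))^2)"
  proof -
    have n: "real n \<ge> 1" using assms by simp
    have "(1 + real n)^2 \<le> (2 * real n)^2" using n by (intro power_mono) auto
    also have "\<dots> \<le> (2 * real n)^2 * real n" using n by simp
    also have "\<dots> \<le> 2 * (real n)^2 * (1 + 2 * real n)" using n by (simp add: algebra_simps power2_eq_square)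
    finally have le: "2 * (1 + real n)^2 \<le> 4 * (real n)^2 * (1 + 2 * real n)" by simp
    have "2 / (real n)^4 = 2 * (1 + real n)^2 / ((real n)^4 * (1 + real n)^2)"
      using n by simp
    also have "\<dots> \<le> 4 * (real n)^2 * (1 + 2 * real n) / ((real n)^4 * (1 + real n)^2)"
      by (rule divide_right_mono[OF le]) simp
    also have "\<dots> = 4 * (1 / (real n)^2 - 1 / (1 + real n)^2)"
    proof -
      define u where "u = real n"
      have "u \<noteq> 0" "1 + u \<noteq> 0" using n by (auto simp: u_def)
      thus ?thesis unfolding u_def[symmetric] by (simp add: divide_simps) algebra
    qed
    finally show ?thesis by simp
  qed
  finally show ?thesis .
qed

lemma stirling_rest_limit:
  obtains c where "stirling_rest \<longlonglongrightarrow> c"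
    and "\<And>n. n \<ge> 1 \<Longrightarrow> \<bar>stirling_rest n - 1 / (12 * real n) - c\<bar> \<le> 4 / (real n)^2"
proof -
  define r where "r n = stirling_rest (Suc n) - 1 / (12 * real (Suc n))" for n
  define z where "z n = 4 / (real (Suc n))^2" for n
  have step: "\<bar>r n - r (Suc n)\<bar> \<le> z n - z (Suc n)" for n
    using stirling_rest_step[of "Suc n"] by (simp add: r_def z_def)
  (* Adding or subtracting the telescoping majorant makes the sequence monotone; both monotone
     sequences have the same limit, so they enclose it with the required rate. *)
  have dec: "decseq (\<lambda>n. r n + z n)" and inc: "incseq (\<lambda>n. r n - z n)"
  proof -
    have "r (Suc n) + z (Suc n) \<le> r n + z n" "r n - z n \<le> r (Suc n) - z (Suc n)" for n
      using step[of n] by linarith+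
    thus "decseq (\<lambda>n. r n + z n)" "incseq (\<lambda>n. r n - z n)"
      by (auto intro!: decseq_SucI incseq_SucI)
  qed
  have z0: "z n \<ge> 0" for n by (simp add: z_def)
  have zlim: "z \<longlonglongrightarrow> 0" unfolding z_def by real_asymp
  have "\<forall>n. r n - z n \<le> r 0 + z 0"
  proof
    fix n show "r n - z n \<le> r 0 + z 0" using decseqD[OF dec, of 0 n] z0[of n] by simp
  qed
  then obtain c where c: "(\<lambda>n. r n - z n) \<longlonglongrightarrow> c" "\<And>n. r n - z n \<le> c"
    using incseq_convergent[OF inc] by blast
  have rlim: "r \<longlonglongrightarrow> c" using tendsto_add[OF c(1) zlim] by simp
  have "(\<lambda>n. r n + z n) \<longlonglongrightarrow> c" using tendsto_add[OF rlim zlim] by simp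
  hence c2: "c \<le> r n + z n" for n using decseq_ge[OF dec] by blast
  show ?thesis
  proof (rule that[of c])
    have "(\<lambda>n. 1 / (12 * real (Suc n))) \<longlonglongrightarrow> 0" by real_asymp
    from tendsto_add[OF rlim this] have "(\<lambda>n. stirling_rest (Suc n)) \<longlonglongrightarrow> c" by (simp add: r_def)
    thus "stirling_rest \<longlonglongrightarrow> c" by (rule LIMSEQ_imp_Suc)
  next
    fix n :: nat assume "n \<ge> 1"
    then obtain m where m: "n = Suc m" by (cases n) auto
    show "\<bar>stirling_rest n - 1 / (12 * real n) - c\<bar> \<le> 4 / (real n)^2"
      using c(2)[of m] c2[of m] unfolding m r_def z_def by (simp add: abs_le_iff algebra_simps)
  qed
qed

text \<open>
  The closed form turns Wallis' product into a statement about \<open>n!\<close> and \<open>(2 * n)!\<close>, which is what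
  determines the constant in Stirling's formula.
\<close>

lemma wallis_product_fact:
  "(\<Prod>k=1..n. (4 * real k^2) / (4 * real k^2 - 1)) = 2^(4*n) * fact n ^ 4 / (fact (2*n) ^ 2 * (2 * real n + 1))"
proof (induction n)
  case (Suc n)
  have nz: "2 * real n + 1 \<noteq> 0" "2 * real n + 3 \<noteq> 0" "real n + 1 \<noteq> 0" by linarith+
  have f: "fact (2 * Suc n) = (2 * real n + 2) * (2 * real n + 1) * fact (2*n)" by (simp add: algebra_simps)
  have q: "4 * real (Suc n)^2 - 1 = (2 * real n + 1) * (2 * real n + 3)" by (simp add: algebra_simps power2_eq_square)
  have "(\<Prod>k=1..Suc n. (4 * real k^2) / (4 * real k^2 - 1))
     = 2^(4*n) * fact n ^ 4 / (fact (2*n) ^ 2 * (2 * real n + 1)) * ((4 * (real n + 1)^2) / ((2 * real n + 1) * (2 * real n + 3)))"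
  proof -
    have "(\<Prod>k=1..Suc n. (4 * real k^2) / (4 * real k^2 - 1))
        = (\<Prod>k=1..n. (4 * real k^2) / (4 * real k^2 - 1)) * ((4 * real (Suc n)^2) / (4 * real (Suc n)^2 - 1))"
      by simp
    thus ?thesis unfolding Suc.IH q by (simp add: add.commute)
  qed
  also have "\<dots> = 2^(4*Suc n) * fact (Suc n) ^ 4 / (fact (2*Suc n) ^ 2 * (2 * real (Suc n) + 1))"
  proof -
    have fs: "fact (Suc n) = (real n + 1) * fact n" by (simp add: algebra_simps)
    have p: "2 ^ (4 * Suc n) = (16::real) * 2^(4*n)" by (simp add: eval_nat_numeral)
    have l: "2 * real (Suc n) + 1 = 2 * real n + 3" by simp
    define F G u where "F = (fact n :: real)" and "G = (fact (2*n) :: real)" and "u = real n"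
    have "G \<noteq> 0" by (simp add: G_def)
    moreover have "2 * u + 2 = 2 * (u + 1)" by simp
    ultimately show ?thesis using nz unfolding fs p l f F_def[symmetric] G_def[symmetric] u_def[symmetric]
      by (simp add: divide_simps power_mult_distrib) algebra
  qed
  finally show ?case .
qed auto

text \<open>
  If \<open>c\<close> is the limit, inserting \<open>stirling_rest\<close> into the logarithm of Wallis' product leaves
  \<open>4 * c - 2 * c - 2 * ln 2\<close> in the limit, and this has to equal \<open>ln (pi / 2)\<close>.
\<close>

lemma stirling_rest_tendsto: "stirling_rest \<longlonglongrightarrow> ln (2 * pi) / 2"
proof -
  obtain c where c: "stirling_rest \<longlonglongrightarrow> c" using stirling_rest_limit by blast
  have sub: "(\<lambda>n. stirling_rest (2 * n)) \<longlonglongrightarrow> c"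
    using LIMSEQ_subseq_LIMSEQ[OF c, of "\<lambda>n. 2 * n"] by (simp add: strict_mono_def o_def)
  define W where "W n = (\<Prod>k=1..n. (4 * real k^2) / (4 * real k^2 - 1))" for n
  have "(\<lambda>n. ln (W n)) \<longlonglongrightarrow> ln (pi / 2)"
    using wallis unfolding W_def by (intro tendsto_ln) auto
  moreover have "(\<lambda>n. ln (W n)) \<longlonglongrightarrow> 4 * c - 2 * c - 2 * ln 2"
  proof -
    have "(\<lambda>n. ln (real n) - ln (2 * real n + 1)) \<longlonglongrightarrow> - ln 2" by real_asymp
    hence "(\<lambda>n. 4 * stirling_rest n - 2 * stirling_rest (2 * n) - ln 2 + (ln (real n) - ln (2 * real n + 1)))
        \<longlonglongrightarrow> 4 * c - 2 * c - ln 2 + (- ln 2)"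
      using c sub by (intro tendsto_intros)
    moreover have "\<forall>\<^sub>F n in sequentially. 4 * stirling_rest n - 2 * stirling_rest (2 * n) - ln 2 + (ln (real n) - ln (2 * real n + 1)) = ln (W n)"
      using eventually_gt_at_top[of 0]
    proof eventually_elim
      case (elim n)
      have l2: "ln (real (2 * n)) = ln 2 + ln (real n)" using elim by (simp add: ln_mult)
      have "ln (W n) = 4 * real n * ln 2 + 4 * ln (fact n) - 2 * ln (fact (2*n)) - ln (2 * real n + 1)"
        unfolding W_def wallis_product_fact
        by (simp add: ln_div ln_mult ln_realpow)
      thus ?case using elim unfolding stirling_rest_def l2 by (simp add: field_simps)
    qed
    ultimately have "(\<lambda>n. ln (W n)) \<longlonglongrightarrow> 4 * c - 2 * c - ln 2 + (- ln 2)"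
      by (rule Lim_transform_eventually)
    thus ?thesis by (simp add: algebra_simps)
  qed
  ultimately have "ln (pi / 2) = 2 * c - 2 * ln 2" using LIMSEQ_unique by fastforce
  hence "c = ln (2 * pi) / 2" by (simp add: ln_div ln_mult)
  with c show ?thesis by (simp only:)
qed

lemma stirling_ln_fact:
  assumes "n \<ge> 1"
  shows "\<bar>ln (fact n) - (real n * ln (real n) - real n + ln (2 * pi * real n) / 2 + 1 / (12 * real n))\<bar> \<le> 4 / (real n)^2"
proof -
  obtain c where c: "stirling_rest \<longlonglongrightarrow> c" "\<bar>stirling_rest n - 1 / (12 * real n) - c\<bar> \<le> 4 / (real n)^2"
    using stirling_rest_limit assms by metis
  have "c = ln (2 * pi) / 2" using LIMSEQ_unique[OF c(1) stirling_rest_tendsto] .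
  thus ?thesis using c(2) assms by (simp add: stirling_rest_def ln_mult algebra_simps add_divide_distrib)
qed

section \<open>Local expansion of the Poisson distribution\<close>

text \<open>
  The logarithm of the quotient of two values at \<open>k\<close>: that of the Poisson(\<open>l\<close>) mass function and
  that of the normal density with mean and variance \<open>l\<close>.
\<close>

definition poisson_log :: "real \<Rightarrow> nat \<Rightarrow> real" where
  "poisson_log l k = real k * ln l - l - ln (fact k) + ln (2 * pi * l) / 2 + (real k - l)^2 / (2 * l)"

definition poisson_expansion :: "real \<Rightarrow> real \<Rightarrow> real" where
  "poisson_expansion l y = l * y^3 / 6 - l * y^4 / 12 - y / 2 + y^2 / 4 - 1 / (12 * l)"

text \<open>
  Stirling's formula, with \<open>k = l * (1 + y)\<close>, turns \<open>poisson_log l k\<close> into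
  \<open>- (l * (1 + y) + 1 / 2) * ln (1 + y) + l * y + l * y\<^sup>2 / 2 - 1 / (12 * l * (1 + y))\<close>. In the Taylor expansion of
  the logarithm the terms \<open>l * y\<close> and \<open>l * y\<^sup>2\<close> cancel. The four error terms come from the fifth order
  remainder multiplied by \<open>l\<close>, from the third order remainder of \<open>ln (1 + y) / 2\<close>, from replacing
  \<open>1 / (12 * k)\<close> by \<open>1 / (12 * l)\<close>, and from Stirling's formula.
\<close>

lemma poisson_log_expansion:
  fixes l \<eta> y :: real and k :: nat
  assumes \<eta>: "0 \<le> \<eta>" "\<eta> < 1" and l: "0 < l" and k: "real k = l * (1 + y)" and y: "\<bar>y\<bar> \<le> \<eta>"
  shows "\<bar>poisson_log l k - poisson_expansion l y\<bar>
           \<le> 4 / (1 - \<eta>)^2 * (l * \<bar>y\<bar>^5 + \<bar>y\<bar>^3 + \<bar>y\<bar> / l + 1 / l^2)"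
proof -
  define q where "q = 1 / (1 - \<eta>)"
  have "1 \<le> q" using \<eta> by (simp add: q_def)
  hence q: "1 \<le> q" "q \<le> q^2" by (simp_all add: self_le_power)
  have y1: "1 + y > 0" "\<bar>1 + y\<bar> \<le> 2" "\<bar>y\<bar> \<le> 1" "1 - \<eta> \<le> 1 + y" using y \<eta> by auto
  have inv: "1 / (1 + y) \<le> q" unfolding q_def using y1 \<eta> by (intro divide_left_mono) auto
  have "0 < real k" unfolding k using l y1(1) by simp
  hence k0: "k \<ge> 1" by simp
  define e where "e = ln (1 + y) - (y - y^2/2 + y^3/3 - y^4/4)"
  have e: "\<bar>e\<bar> \<le> q * \<bar>y\<bar>^5"
    using ln_one_plus_quartic_error[of \<eta> y] y \<eta> by (simp add: e_def q_def)
  define s where "s = ln (fact k) - (real k * ln (real k) - real k + ln (2 * pi * real k) / 2 + 1 / (12 * real k))"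
  have "\<bar>s\<bar> \<le> 4 / (real k)^2" unfolding s_def by (rule stirling_ln_fact[OF k0])
  also have "\<dots> = 4 * (1 / (1 + y))^2 * (1 / l^2)" by (simp add: k power_mult_distrib power_divide)
  also have "\<dots> \<le> 4 * q^2 * (1 / l^2)"
    using inv y1 by (intro mult_right_mono mult_left_mono power_mono) auto
  finally have s: "\<bar>s\<bar> \<le> 4 * q^2 * (1 / l^2)" .
  have lnk: "ln (real k) = ln l + ln (1 + y)" unfolding k using l y1 by (simp add: ln_mult)
  have ln2k: "ln (2 * pi * real k) = ln (2 * pi * l) + ln (1 + y)"
    using k0 l lnk by (simp add: ln_mult)
  have "poisson_log l k = real k * ln l - l - (s + (real k * ln (real k) - real k + ln (2 * pi * real k) / 2 + 1 / (12 * real k)))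
          + ln (2 * pi * l) / 2 + (real k - l)^2 / (2 * l)"
    unfolding poisson_log_def s_def by simp
  also have "\<dots> = - (l * (1 + y) + 1/2) * ln (1 + y) + l * y + l * y^2 / 2 - 1 / (12 * l * (1 + y)) - s"
  proof -
    have "(l * (1 + y) - l)^2 / (2 * l) = l * y^2 / 2"
      using l by (simp add: field_simps power2_eq_square)
    moreover have "1 / (12 * (l * (1 + y))) = 1 / (12 * l * (1 + y))" by (simp only: mult.assoc)
    ultimately show ?thesis
      unfolding lnk ln2k unfolding k by (simp add: algebra_simps add_divide_distrib)
  qed
  finally have 1: "poisson_log l k = - (l * (1 + y) + 1/2) * ln (1 + y) + l * y + l * y^2 / 2 - 1 / (12 * l * (1 + y)) - s" .
  have ln_e: "ln (1 + y) = e + (y - y^2/2 + y^3/3 - y^4/4)" by (simp add: e_def)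
  have inv1: "1 / (12 * l) - 1 / (12 * l * (1 + y)) = y / l * (1 / (1 + y)) / 12"
  proof -
    define z u where "z = 1 / (1 + y)" and "u = 1 / (12 * l)"
    have "1 - z = y * z" using y1(1) by (simp add: z_def field_simps)
    hence "u - u * z = u * (y * z)" using right_diff_distrib[of u 1 z] by simp
    moreover have "1 / (12 * l * (1 + y)) = u * z" "y / l * z / 12 = u * (y * z)"
      by (simp_all add: u_def z_def)
    ultimately show ?thesis by (simp only: z_def[symmetric] u_def[symmetric])
  qed
  have "poisson_log l k - poisson_expansion l y
      = - (l * (1 + y) * e) - e / 2 + l * y^5 / 4 - y^3 / 6 + y^4 / 8
        + (1 / (12 * l) - 1 / (12 * l * (1 + y))) - s"
    unfolding 1 ln_e poisson_expansion_def by (simp add: field_simps eval_nat_numeral)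
  hence eq: "poisson_log l k - poisson_expansion l y
      = - (l * (1 + y) * e) - e / 2 + l * y^5 / 4 - y^3 / 6 + y^4 / 8 + y / l * (1 / (1 + y)) / 12 - s"
    unfolding inv1 .
  define E5 E3 E1 E0 where "E5 = l * \<bar>y\<bar>^5" and "E3 = \<bar>y\<bar>^3" and "E1 = \<bar>y\<bar> / l" and "E0 = 1 / l^2"
  have E: "E5 \<ge> 0" "E3 \<ge> 0" "E1 \<ge> 0" "E0 \<ge> 0" using l by (auto simp: E5_def E3_def E1_def E0_def)
  have "\<bar>l * (1 + y) * e\<bar> = l * \<bar>1 + y\<bar> * \<bar>e\<bar>" using l by (simp add: abs_mult)
  also have "\<dots> \<le> l * 2 * (q * \<bar>y\<bar>^5)" using l y1 e by (intro mult_mono) auto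
  finally have b1: "\<bar>l * (1 + y) * e\<bar> \<le> 2 * (q * E5)" by (simp add: E5_def mult_ac)
  have y53: "\<bar>y\<bar>^5 \<le> \<bar>y\<bar>^3" "\<bar>y\<bar>^4 \<le> \<bar>y\<bar>^3" using y1(3) by (intro power_decreasing; simp)+
  have "\<bar>e\<bar> \<le> q * \<bar>y\<bar>^3" by (rule order.trans[OF e]) (use y53 q in \<open>auto intro!: mult_left_mono\<close>)
  hence b2: "\<bar>e / 2\<bar> \<le> q * E3 / 2" by (simp add: E3_def)
  have b3: "\<bar>l * y^5 / 4\<bar> \<le> E5 / 4" using l by (simp add: E5_def abs_mult power_abs)
  have b4: "\<bar>y^3 / 6\<bar> \<le> E3 / 6" by (simp add: E3_def power_abs)
  have b5: "\<bar>y^4 / 8\<bar> \<le> E3 / 8" using y53(2) by (simp add: E3_def power_abs)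
  have "\<bar>y / l * (1 / (1 + y))\<bar> = E1 * (1 / (1 + y))" using l y1(1) by (simp add: E1_def abs_mult)
  also have "\<dots> \<le> E1 * q" using inv E by (intro mult_left_mono)
  finally have "\<bar>y / l * (1 / (1 + y))\<bar> \<le> q * E1" by (simp only: mult.commute)
  moreover have "\<bar>v / 12\<bar> \<le> c / 12" if "\<bar>v\<bar> \<le> c" for v c :: real using that by simp
  ultimately have b6: "\<bar>y / l * (1 / (1 + y)) / 12\<bar> \<le> q * E1 / 12" by blast
  have b7: "\<bar>s\<bar> \<le> 4 * (q^2 * E0)" using s by (simp add: E0_def)
  have qq: "q * E5 \<le> q^2 * E5" "q * E3 \<le> q^2 * E3" "q * E1 \<le> q^2 * E1" "0 \<le> q^2 * E0" "0 \<le> q^2 * E1"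
    using q E by (auto intro!: mult_right_mono)
  have "E5 \<le> q^2 * E5" "E3 \<le> q^2 * E3"
    using mult_right_mono[OF order.trans[OF q] E(1)] mult_right_mono[OF order.trans[OF q] E(2)] by simp_all
  note qq = qq this
  have tri: "\<bar>- x1 - x2 + x3 - x4 + x5 + x6 - x7\<bar> \<le> \<bar>x1\<bar> + \<bar>x2\<bar> + \<bar>x3\<bar> + \<bar>x4\<bar> + \<bar>x5\<bar> + \<bar>x6\<bar> + \<bar>x7\<bar>"
    for x1 x2 x3 x4 x5 x6 x7 :: real by linarith
  have "\<bar>poisson_log l k - poisson_expansion l y\<bar>
      \<le> 4 * (q^2 * E5) + 4 * (q^2 * E3) + 4 * (q^2 * E1) + 4 * (q^2 * E0)"
    unfolding eq by (rule order.trans[OF tri]) (use b1 b2 b3 b4 b5 b6 b7 qq E in linarith)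
  also have "\<dots> = 4 / (1 - \<eta>)^2 * (E5 + E3 + E1 + E0)"
    by (simp add: q_def power_divide algebra_simps add_divide_distrib)
  finally show ?thesis by (simp add: E5_def E3_def E1_def E0_def)
qed

section \<open>Exponentiating a second order expansion\<close>

text \<open>
  Here \<open>\<epsilon>\<close> stands for \<open>1 / sqrt N\<close> and \<open>w\<close> for one plus the norm of the standardised deviation. The
  condition \<open>w ^ 3 * \<epsilon> \<le> 8\<close> says that the leading term of \<open>L\<close> stays bounded although \<open>w\<close> may grow
  with \<open>N\<close>; it bounds the exponential in the Taylor remainder, and it lets every higher product
  be absorbed. The cubic remainder is of the order \<open>(w ^ 3 * \<epsilon>) ^ 3\<close>, which is where the ninth power of
  \<open>w\<close> comes from. The constant \<open>D\<close> is the one in \<open>\<bar>L\<bar> \<le> D * (w ^ 3 * \<epsilon>)\<close>.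
\<close>

lemma exp_second_order_error:
  fixes w \<epsilon> a b L A B R :: real
  assumes w: "1 \<le> w" and \<epsilon>: "0 \<le> \<epsilon>" "w^3 * \<epsilon> \<le> 8" and nn: "0 \<le> A" "0 \<le> B" "0 \<le> R"
    and a: "\<bar>a\<bar> \<le> A * w^3" and b: "\<bar>b\<bar> \<le> B * w^4"
    and L: "\<bar>L - (\<epsilon> * a + \<epsilon>^2 * b)\<bar> \<le> R * (w^5 * \<epsilon>^3)"
  defines "D \<equiv> A + 8 * (B + 8 * R)"
  shows "\<bar>exp L - (1 + \<epsilon> * a + \<epsilon>^2 * (a^2 / 2 + b))\<bar>
           \<le> (R + (B + 8 * R) * (A + D) / 2 + exp (8 * D) * D^3 / 6) * (w^9 * \<epsilon>^3)"
proof -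
  have D: "D \<ge> 0" using nn by (simp add: D_def)
  have "w * \<epsilon> \<le> w^3 * \<epsilon>" using w \<epsilon> power_increasing[of 1 3 w] by (intro mult_right_mono) auto
  hence we: "w * \<epsilon> \<le> 8" using \<epsilon> by linarith
  have "w^5 * \<epsilon>^3 = (w^4 * \<epsilon>^2) * (w * \<epsilon>)" by (simp add: eval_nat_numeral)
  also have "\<dots> \<le> (w^4 * \<epsilon>^2) * 8" using we by (intro mult_left_mono) auto
  finally have w5: "w^5 * \<epsilon>^3 \<le> 8 * (w^4 * \<epsilon>^2)" by simp
  have "w^4 * \<epsilon>^2 = (w^3 * \<epsilon>) * (w * \<epsilon>)" by (simp add: eval_nat_numeral)
  also have "\<dots> \<le> (w^3 * \<epsilon>) * 8" using we w \<epsilon> by (intro mult_left_mono) auto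
  finally have w4: "w^4 * \<epsilon>^2 \<le> 8 * (w^3 * \<epsilon>)" by simp
  have ea: "\<bar>\<epsilon> * a\<bar> \<le> A * (w^3 * \<epsilon>)"
    using mult_left_mono[OF a \<epsilon>(1)] \<epsilon> by (simp add: abs_mult mult_ac)
  have eb: "\<bar>\<epsilon>^2 * b\<bar> \<le> B * (w^4 * \<epsilon>^2)"
    using mult_left_mono[OF b, of "\<epsilon>^2"] by (simp add: abs_mult mult_ac)
  have R5: "R * (w^5 * \<epsilon>^3) \<le> R * (8 * (w^4 * \<epsilon>^2))" using w5 nn by (intro mult_left_mono)
  have La: "\<bar>L - \<epsilon> * a\<bar> \<le> (B + 8 * R) * (w^4 * \<epsilon>^2)"
    using L eb R5 by (simp add: algebra_simps)
  have "(B + 8 * R) * (w^4 * \<epsilon>^2) \<le> (B + 8 * R) * (8 * (w^3 * \<epsilon>))"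
    using w4 nn by (intro mult_left_mono) auto
  hence LD: "\<bar>L\<bar> \<le> D * (w^3 * \<epsilon>)"
    using La ea unfolding D_def by (simp add: algebra_simps)
  have "D * (w^3 * \<epsilon>) \<le> D * 8" using \<epsilon> D by (intro mult_left_mono)
  hence L8: "\<bar>L\<bar> \<le> 8 * D" using LD by linarith
  have quad: "\<bar>(L^2 - (\<epsilon> * a)^2) / 2\<bar> \<le> ((B + 8 * R) * (A + D) / 2) * (w^9 * \<epsilon>^3)"
  proof -
    have "\<bar>(L^2 - (\<epsilon> * a)^2)\<bar> = \<bar>L - \<epsilon> * a\<bar> * \<bar>L + \<epsilon> * a\<bar>"
      by (simp add: abs_mult [symmetric] power2_eq_square algebra_simps)
    also have "\<bar>L + \<epsilon> * a\<bar> \<le> (A + D) * (w^3 * \<epsilon>)" using LD ea by (simp add: algebra_simps)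
    hence "\<bar>L - \<epsilon> * a\<bar> * \<bar>L + \<epsilon> * a\<bar> \<le> ((B + 8 * R) * (w^4 * \<epsilon>^2)) * ((A + D) * (w^3 * \<epsilon>))"
      using La by (intro mult_mono) (auto intro: nn add_nonneg_nonneg mult_nonneg_nonneg simp: nn)
    also have "\<dots> = ((B + 8 * R) * (A + D)) * (w^7 * \<epsilon>^3)" by (simp add: eval_nat_numeral)
    also have "\<dots> \<le> ((B + 8 * R) * (A + D)) * (w^9 * \<epsilon>^3)"
      using w \<epsilon> nn D by (intro mult_left_mono mult_right_mono power_increasing) auto
    finally show ?thesis by (simp add: abs_divide)
  qed
  obtain t where t: "\<bar>t\<bar> \<le> \<bar>L\<bar>" "exp L = (\<Sum>m<3. L ^ m / fact m) + exp t / fact 3 * L ^ 3"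
    using Maclaurin_exp_le by blast
  have expL: "exp L = 1 + L + L^2 / 2 + exp t / 6 * L^3"
    using t(2) by (simp add: eval_nat_numeral)
  have cubic: "\<bar>exp t / 6 * L^3\<bar> \<le> (exp (8 * D) * D^3 / 6) * (w^9 * \<epsilon>^3)"
  proof -
    have "\<bar>exp t / 6 * L^3\<bar> = exp t / 6 * \<bar>L\<bar>^3" by (simp add: abs_mult power_abs)
    also have "\<dots> \<le> exp (8 * D) / 6 * (D * (w^3 * \<epsilon>))^3"
      using t(1) L8 LD by (intro mult_mono power_mono divide_right_mono) auto
    also have "\<dots> = (exp (8 * D) * D^3 / 6) * (w^9 * \<epsilon>^3)"
      by (simp add: power_mult_distrib flip: power_mult)
    finally show ?thesis .
  qed
  have "R * (w^5 * \<epsilon>^3) \<le> R * (w^9 * \<epsilon>^3)"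
    using w \<epsilon> nn by (intro mult_left_mono mult_right_mono power_increasing) auto
  hence lin: "\<bar>L - (\<epsilon> * a + \<epsilon>^2 * b)\<bar> \<le> R * (w^9 * \<epsilon>^3)" using L by linarith
  have "exp L - (1 + \<epsilon> * a + \<epsilon>^2 * (a^2 / 2 + b))
      = (L - (\<epsilon> * a + \<epsilon>^2 * b)) + (L^2 - (\<epsilon> * a)^2) / 2 + exp t / 6 * L^3"
    unfolding expL by (simp add: algebra_simps power_mult_distrib diff_divide_distrib)
  also have "\<bar>\<dots>\<bar> \<le> R * (w^9 * \<epsilon>^3) + ((B + 8 * R) * (A + D) / 2) * (w^9 * \<epsilon>^3) + (exp (8 * D) * D^3 / 6) * (w^9 * \<epsilon>^3)"
    using lin quad cubic by linarith
  finally show ?thesis by (simp only: distrib_right)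
qed

section \<open>Independent Poisson counts conditioned on their sum\<close>

text \<open>
  The coefficients of \<open>1 / sqrt N\<close> and \<open>1 / N\<close> in \<open>poisson_expansion (N * P) (x / (sqrt N * P))\<close>.
\<close>

definition category_half :: "real \<Rightarrow> real \<Rightarrow> real" where
  "category_half P x = x * (x / P)^2 / 6 - x / P / 2"

definition category_one :: "real \<Rightarrow> real \<Rightarrow> real" where
  "category_one P x = (x / P)^2 / 4 - x * (x / P)^3 / 12 - 1 / (12 * P)"

text \<open>
  The summand \<open>1 / 12\<close> comes from the conditioning on the sum: it is the negative of the contribution
  \<open>category_one 1 0\<close> of the total count.
\<close>

definition category_expansion :: "nat \<Rightarrow> ('i::finite \<Rightarrow> real) \<Rightarrow> ('i \<Rightarrow> real) \<Rightarrow> real" where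
  "category_expansion N P x = 1 + 1 / sqrt (real N) * (\<Sum>i\<in>UNIV. category_half (P i) (x i))
     + (1 / sqrt (real N))^2 * ((\<Sum>i\<in>UNIV. category_half (P i) (x i))^2 / 2
          + ((\<Sum>i\<in>UNIV. category_one (P i) (x i)) + 1 / 12))"

text \<open>
  The bound \<open>\<bar>x\<bar> \<le> \<eta> * (sqrt N * P)\<close> keeps the relative deviation \<open>y\<close> of \<open>K\<close> from its mean \<open>N * P\<close> within
  \<open>[- \<eta>, \<eta>]\<close>. With \<open>\<epsilon> = 1 / sqrt N\<close>, each of the four errors of \<open>poisson_log_expansion\<close> then
  carries at least the factor \<open>\<epsilon> ^ 3\<close>, accompanied by at most five factors \<open>\<bar>x\<bar>\<close>.
\<close>

lemma poisson_log_category: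
  fixes P x w \<eta> :: real and N K :: nat
  assumes \<eta>: "0 \<le> \<eta>" "\<eta> < 1" and P: "0 < P" and N: "1 \<le> N"
    and K: "real K = real N * P + sqrt (real N) * x"
    and x: "\<bar>x\<bar> \<le> \<eta> * (sqrt (real N) * P)" and w: "1 \<le> w" "\<bar>x\<bar> \<le> w"
  defines "\<epsilon> \<equiv> 1 / sqrt (real N)"
  shows "\<bar>poisson_log (real N * P) K - (\<epsilon> * category_half P x + \<epsilon>^2 * category_one P x)\<bar>
           \<le> 4 / (1 - \<eta>)^2 * (1 / P^4 + 1 / P^3 + 2 / P^2) * (w^5 * \<epsilon>^3)"
proof -
  have \<epsilon>: "0 < \<epsilon>" "\<epsilon> \<le> 1" using N by (auto simp: \<epsilon>_def)
  have sN: "sqrt (real N) = 1 / \<epsilon>" using N by (simp add: \<epsilon>_def)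
  have "real N = (sqrt (real N))^2" by simp
  hence NE: "real N = 1 / \<epsilon>^2" unfolding sN by (simp add: power_divide)
  define y where "y = \<epsilon> * x / P"
  have y_abs: "\<bar>y\<bar> = \<epsilon> * \<bar>x\<bar> / P" using \<epsilon> P by (simp add: y_def abs_mult)
  have K': "real K = real N * P * (1 + y)"
    unfolding K sN unfolding NE y_def using \<epsilon> P by (simp add: field_simps power2_eq_square)
  have y: "\<bar>y\<bar> \<le> \<eta>" using x \<epsilon> P unfolding y_abs sN by (simp add: field_simps)
  have main: "\<bar>poisson_log (real N * P) K - poisson_expansion (real N * P) y\<bar>
      \<le> 4 / (1 - \<eta>)^2 * (real N * P * \<bar>y\<bar>^5 + \<bar>y\<bar>^3 + \<bar>y\<bar> / (real N * P) + 1 / (real N * P)^2)"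
    using N P by (intro poisson_log_expansion \<eta> K' y) auto
  have expansion: "poisson_expansion (real N * P) y = \<epsilon> * category_half P x + \<epsilon>^2 * category_one P x"
    unfolding poisson_expansion_def category_half_def category_one_def y_def NE
    using \<epsilon> P by (simp add: field_simps eval_nat_numeral)
  have wpow: "\<bar>x\<bar>^n \<le> w^5" if "n \<le> 5" for n
  proof -
    have "\<bar>x\<bar>^n \<le> w^n" using w by (intro power_mono) auto
    also have "\<dots> \<le> w^5" using w that by (intro power_increasing)
    finally show ?thesis .
  qed
  have e5: "real N * P * \<bar>y\<bar>^5 \<le> 1 / P^4 * (w^5 * \<epsilon>^3)"
  proof -
    have "real N * P * \<bar>y\<bar>^5 = 1 / P^4 * (\<bar>x\<bar>^5 * \<epsilon>^3)"
      unfolding y_abs NE using \<epsilon> P by (simp add: field_simps eval_nat_numeral)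
    also have "\<dots> \<le> 1 / P^4 * (w^5 * \<epsilon>^3)"
      using \<epsilon> P by (intro mult_left_mono mult_right_mono wpow) auto
    finally show ?thesis .
  qed
  have e3: "\<bar>y\<bar>^3 \<le> 1 / P^3 * (w^5 * \<epsilon>^3)"
  proof -
    have "\<bar>y\<bar>^3 = 1 / P^3 * (\<bar>x\<bar>^3 * \<epsilon>^3)"
      unfolding y_abs by (simp add: power_mult_distrib power_divide)
    also have "\<dots> \<le> 1 / P^3 * (w^5 * \<epsilon>^3)"
      using \<epsilon> P by (intro mult_left_mono mult_right_mono wpow) auto
    finally show ?thesis .
  qed
  have e1: "\<bar>y\<bar> / (real N * P) \<le> 1 / P^2 * (w^5 * \<epsilon>^3)"
  proof -
    have "\<bar>y\<bar> / (real N * P) = 1 / P^2 * (\<bar>x\<bar>^1 * \<epsilon>^3)"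
      unfolding y_abs NE using \<epsilon> P by (simp add: field_simps eval_nat_numeral)
    also have "\<dots> \<le> 1 / P^2 * (w^5 * \<epsilon>^3)"
      using \<epsilon> P by (intro mult_left_mono mult_right_mono wpow) auto
    finally show ?thesis .
  qed
  have e0: "1 / (real N * P)^2 \<le> 1 / P^2 * (w^5 * \<epsilon>^3)"
  proof -
    have "1 / (real N * P)^2 = 1 / P^2 * (1 * \<epsilon>^4)"
      unfolding NE using \<epsilon> P by (simp add: field_simps eval_nat_numeral)
    also have "\<dots> \<le> 1 / P^2 * (w^5 * \<epsilon>^3)"
      using \<epsilon> P w by (intro mult_left_mono mult_mono power_decreasing) auto
    finally show ?thesis .
  qed
  have "real N * P * \<bar>y\<bar>^5 + \<bar>y\<bar>^3 + \<bar>y\<bar> / (real N * P) + 1 / (real N * P)^2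
      \<le> (1 / P^4 + 1 / P^3 + 2 / P^2) * (w^5 * \<epsilon>^3)"
    using e5 e3 e1 e0 by (simp add: distrib_right)
  hence "4 / (1 - \<eta>)^2 * (real N * P * \<bar>y\<bar>^5 + \<bar>y\<bar>^3 + \<bar>y\<bar> / (real N * P) + 1 / (real N * P)^2)
      \<le> 4 / (1 - \<eta>)^2 * ((1 / P^4 + 1 / P^3 + 2 / P^2) * (w^5 * \<epsilon>^3))"
    by (intro mult_left_mono) auto
  thus ?thesis using main unfolding expansion by (simp only: mult.assoc)
qed

lemma category_half_bound:
  assumes "0 < P" "1 \<le> w" "\<bar>x\<bar> \<le> w"
  shows "\<bar>category_half P x\<bar> \<le> (1 / (6 * P^2) + 1 / (2 * P)) * w^3"
proof -
  have wpow: "\<bar>x\<bar>^n \<le> w^3" if "n \<le> 3" for n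
    by (rule order.trans[OF power_mono[of "\<bar>x\<bar>" w] power_increasing]) (use assms that in auto)
  have "\<bar>category_half P x\<bar> \<le> 1 / (6 * P^2) * \<bar>x\<bar>^3 + 1 / (2 * P) * \<bar>x\<bar>^1"
    unfolding category_half_def by (rule order.trans[OF abs_triangle_ineq4])
      (use assms(1) in \<open>simp add: abs_mult power_abs field_simps eval_nat_numeral\<close>)
  also have "\<dots> \<le> 1 / (6 * P^2) * w^3 + 1 / (2 * P) * w^3"
    using assms(1) by (intro add_mono mult_left_mono wpow) auto
  finally show ?thesis by (simp only: distrib_right)
qed

lemma category_one_bound:
  assumes "0 < P" "1 \<le> w" "\<bar>x\<bar> \<le> w"
  shows "\<bar>category_one P x\<bar> \<le> (1 / (4 * P^2) + 1 / (12 * P^3) + 1 / (12 * P)) * w^4"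
proof -
  have wpow: "\<bar>x\<bar>^n \<le> w^4" if "n \<le> 4" for n
    by (rule order.trans[OF power_mono[of "\<bar>x\<bar>" w] power_increasing]) (use assms that in auto)
  have tri: "\<bar>u - v - z\<bar> \<le> \<bar>u\<bar> + \<bar>v\<bar> + \<bar>z\<bar>" for u v z :: real by linarith
  have "\<bar>category_one P x\<bar> \<le> 1 / (4 * P^2) * \<bar>x\<bar>^2 + 1 / (12 * P^3) * \<bar>x\<bar>^4 + 1 / (12 * P) * \<bar>x\<bar>^0"
    unfolding category_one_def by (rule order.trans[OF tri])
      (use assms(1) in \<open>simp add: abs_mult power_abs field_simps eval_nat_numeral\<close>)
  also have "\<dots> \<le> 1 / (4 * P^2) * w^4 + 1 / (12 * P^3) * w^4 + 1 / (12 * P) * w^4"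
    using assms(1) by (intro add_mono mult_left_mono wpow) auto
  finally show ?thesis by (simp only: distrib_right)
qed

text \<open>
  When the \<open>P i\<close> sum to 1, the exponential is the ratio between the conditional probability of the
  counts \<open>K\<close>, given their sum \<open>N\<close>, and its normal approximation, for independent Poisson counts with
  means \<open>N * P i\<close>.
  The numerator and the denominator of the conditional probability are treated by the same Poisson
  expansion; the total count takes the value \<open>N\<close>, which is its mean, so that its deviation is \<open>0\<close>.
\<close>

lemma conditioned_poisson_expansion:
  fixes P :: "'i::finite \<Rightarrow> real" and \<eta> :: real
  assumes P: "\<And>i. 0 < P i" and \<eta>: "0 \<le> \<eta>" "\<eta> < 1"
  obtains C where
    "\<And>(N::nat) (K :: 'i \<Rightarrow> nat) x w. 1 \<le> N \<Longrightarrow> (\<And>i. real (K i) = real N * P i + sqrt (real N) * x i)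
      \<Longrightarrow> (\<And>i. \<bar>x i\<bar> \<le> \<eta> * (sqrt (real N) * P i)) \<Longrightarrow> (\<And>i. \<bar>x i\<bar> \<le> w) \<Longrightarrow> 1 \<le> w
      \<Longrightarrow> w^3 \<le> 8 * sqrt (real N)
      \<Longrightarrow> \<bar>exp ((\<Sum>i\<in>UNIV. poisson_log (real N * P i) (K i)) - poisson_log (real N) N)
           - category_expansion N P x\<bar>
         \<le> C * (w^9 * (1 / sqrt (real N))^3)"
proof -
  define A where "A = (\<Sum>i\<in>UNIV. 1 / (6 * (P i)^2) + 1 / (2 * P i))"
  define B where "B = (\<Sum>i\<in>UNIV. 1 / (4 * (P i)^2) + 1 / (12 * (P i)^3) + 1 / (12 * P i)) + 1 / 12"
  (* The total count enters as a category of probability 1 with deviation 0. *)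
  define R0 where "R0 = 4 / (1 - \<eta>)^2 * (1 / 1^4 + 1 / 1^3 + 2 / 1^2 :: real)"
  define R where "R = (\<Sum>i\<in>UNIV. 4 / (1 - \<eta>)^2 * (1 / (P i)^4 + 1 / (P i)^3 + 2 / (P i)^2)) + R0"
  define D where "D = A + 8 * (B + 8 * R)"
  define C where "C = R + (B + 8 * R) * (A + D) / 2 + exp (8 * D) * D^3 / 6"
  have P0: "0 \<le> P i" for i using P[of i] by simp
  have nn: "0 \<le> A" "0 \<le> B" "0 \<le> R" unfolding A_def B_def R_def R0_def
    using P0 by (auto intro!: sum_nonneg add_nonneg_nonneg mult_nonneg_nonneg divide_nonneg_nonneg)
  show ?thesis
  proof (rule that[of C])
    fix N :: nat and K :: "'i \<Rightarrow> nat" and x w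
    assume N: "1 \<le> N" and K: "\<And>i. real (K i) = real N * P i + sqrt (real N) * x i"
      and x: "\<And>i. \<bar>x i\<bar> \<le> \<eta> * (sqrt (real N) * P i)" and xw: "\<And>i. \<bar>x i\<bar> \<le> w" and w: "1 \<le> w"
      and w3: "w^3 \<le> 8 * sqrt (real N)"
    define \<epsilon> where "\<epsilon> = 1 / sqrt (real N)"
    have \<epsilon>: "0 < \<epsilon>" using N by (simp add: \<epsilon>_def)
    have w3': "w^3 * \<epsilon> \<le> 8" using w3 N by (simp add: \<epsilon>_def field_simps)
    define a where "a = (\<Sum>i\<in>UNIV. category_half (P i) (x i))"
    define b where "b = (\<Sum>i\<in>UNIV. category_one (P i) (x i)) + 1 / 12"
    define L where "L = (\<Sum>i\<in>UNIV. poisson_log (real N * P i) (K i)) - poisson_log (real N) N"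
    have a: "\<bar>a\<bar> \<le> A * w^3"
    proof -
      have "\<bar>a\<bar> \<le> (\<Sum>i\<in>UNIV. \<bar>category_half (P i) (x i)\<bar>)" unfolding a_def by (rule sum_abs)
      also have "\<dots> \<le> (\<Sum>i\<in>UNIV. (1 / (6 * (P i)^2) + 1 / (2 * P i)) * w^3)"
        by (intro sum_mono category_half_bound P w xw)
      finally show ?thesis by (simp only: A_def sum_distrib_right)
    qed
    have b: "\<bar>b\<bar> \<le> B * w^4"
    proof -
      have "\<bar>b\<bar> \<le> (\<Sum>i\<in>UNIV. \<bar>category_one (P i) (x i)\<bar>) + 1 / 12"
        unfolding b_def using sum_abs[of "\<lambda>i. category_one (P i) (x i)" UNIV] by linarith
      also have "\<dots> \<le> (\<Sum>i\<in>UNIV. (1 / (4 * (P i)^2) + 1 / (12 * (P i)^3) + 1 / (12 * P i)) * w^4) + 1 / 12 * w^4"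
        using w by (intro add_mono sum_mono category_one_bound P w xw) simp
      finally show ?thesis by (simp only: B_def sum_distrib_right distrib_right)
    qed
    have L: "\<bar>L - (\<epsilon> * a + \<epsilon>^2 * b)\<bar> \<le> R * (w^5 * \<epsilon>^3)"
    proof -
      let ?err = "\<lambda>i. poisson_log (real N * P i) (K i) - (\<epsilon> * category_half (P i) (x i) + \<epsilon>^2 * category_one (P i) (x i))"
      let ?tot = "poisson_log (real N * 1) N - (\<epsilon> * category_half 1 0 + \<epsilon>^2 * category_one 1 0)"
      have err: "\<bar>?err i\<bar> \<le> 4 / (1 - \<eta>)^2 * (1 / (P i)^4 + 1 / (P i)^3 + 2 / (P i)^2) * (w^5 * \<epsilon>^3)" for i
        unfolding \<epsilon>_def by (rule poisson_log_category[OF \<eta> P N K x w xw])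
      have tot: "\<bar>?tot\<bar> \<le> R0 * (w^5 * \<epsilon>^3)"
        unfolding R0_def \<epsilon>_def by (rule poisson_log_category) (use \<eta> N w in simp_all)
      have "L - (\<epsilon> * a + \<epsilon>^2 * b) = (\<Sum>i\<in>UNIV. ?err i) - ?tot"
        unfolding L_def a_def b_def
        by (simp add: sum_subtractf sum.distrib sum_distrib_left category_half_def category_one_def algebra_simps)
      also have "\<bar>\<dots>\<bar> \<le> (\<Sum>i\<in>UNIV. \<bar>?err i\<bar>) + \<bar>?tot\<bar>"
        using sum_abs[of ?err UNIV] by linarith
      also have "\<dots> \<le> (\<Sum>i\<in>UNIV. 4 / (1 - \<eta>)^2 * (1 / (P i)^4 + 1 / (P i)^3 + 2 / (P i)^2) * (w^5 * \<epsilon>^3)) + R0 * (w^5 * \<epsilon>^3)"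
        by (intro add_mono sum_mono err tot)
      finally show ?thesis by (simp only: R_def sum_distrib_right distrib_right)
    qed
    have "\<bar>exp L - (1 + \<epsilon> * a + \<epsilon>^2 * (a^2 / 2 + b))\<bar> \<le> C * (w^9 * \<epsilon>^3)"
      unfolding C_def D_def by (rule exp_second_order_error[OF w _ w3' nn a b L]) (use \<epsilon> in simp)
    thus "\<bar>exp ((\<Sum>i\<in>UNIV. poisson_log (real N * P i) (K i)) - poisson_log (real N) N)
           - category_expansion N P x\<bar>
         \<le> C * (w^9 * (1 / sqrt (real N))^3)"
      unfolding category_expansion_def L_def a_def b_def \<epsilon>_def .
  qed
qed

section \<open>The symmetrised coefficients\<close>

lemma sum_option: "(\<Sum>i\<in>UNIV. f i) = (\<Sum>i\<in>UNIV. f (Some i)) + f None"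
  for f :: "'a::finite option \<Rightarrow> 'b::comm_monoid_add"
  by (simp add: UNIV_option_conv sum.reindex add.commute)

lemma prod_option: "(\<Prod>i\<in>UNIV. f i) = (\<Prod>i\<in>UNIV. f (Some i)) * f None"
  for f :: "'a::finite option \<Rightarrow> 'b::comm_monoid_mult"
  by (simp add: UNIV_option_conv prod.reindex mult.commute)

lemma sum_cubic_form:
  fixes x a :: "'i::finite \<Rightarrow> real"
  shows "(\<Sum>i\<in>UNIV. \<Sum>j\<in>UNIV. \<Sum>l\<in>UNIV. x i * x j * x l * (a i * of_bool (i = j \<and> j = l) - c))
    = (\<Sum>i\<in>UNIV. x i ^ 3 * a i) - c * (\<Sum>i\<in>UNIV. x i) ^ 3"
proof -
  have "(\<Sum>l\<in>UNIV. x i * x j * x l * (a i * of_bool (i = j \<and> j = l) - c))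
      = of_bool (i = j) * (x i ^ 3 * a i) - c * (x i * x j * (\<Sum>l\<in>UNIV. x l))" for i j
  proof -
    have "x i * x j * x l * (a i * of_bool (i = j \<and> j = l) - c)
        = (if j = l then of_bool (i = j) * (x i ^ 3 * a i) else 0) - c * (x i * x j) * x l" for l
      by (auto simp: power3_eq_cube algebra_simps)
    thus ?thesis by (simp add: sum_subtractf sum_distrib_left mult.assoc)
  qed
  moreover have "(\<Sum>j\<in>UNIV. of_bool (i = j) * (x i ^ 3 * a i) - c * (x i * x j * (\<Sum>l\<in>UNIV. x l)))
      = x i ^ 3 * a i - c * (x i * (\<Sum>j\<in>UNIV. x j) * (\<Sum>l\<in>UNIV. x l))" for i
  proof -
    have "of_bool (i = j) * (x i ^ 3 * a i) - c * (x i * x j * (\<Sum>l\<in>UNIV. x l))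
       = (if i = j then x i ^ 3 * a i else 0) - (c * x i * (\<Sum>l\<in>UNIV. x l)) * x j" for j by auto
    thus ?thesis by (simp only: sum_subtractf flip: sum_distrib_left) (simp add: mult_ac)
  qed
  ultimately show ?thesis
    by (simp add: sum_subtractf power3_eq_cube flip: sum_distrib_left sum_distrib_right)
qed

lemma sum_quartic_form:
  fixes x a :: "'i::finite \<Rightarrow> real"
  shows "(\<Sum>i\<in>UNIV. \<Sum>j\<in>UNIV. \<Sum>l\<in>UNIV. \<Sum>m\<in>UNIV. x i * x j * x l * x m * (a i * of_bool (i = j \<and> j = l \<and> l = m) + c))
    = (\<Sum>i\<in>UNIV. x i ^ 4 * a i) + c * (\<Sum>i\<in>UNIV. x i) ^ 4"
proof -
  (* Carrying out the innermost sum leaves a cubic form, with \<open>x i * a i\<close> in place of \<open>a i\<close>. *)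
  have "(\<Sum>m\<in>UNIV. x i * x j * x l * x m * (a i * of_bool (i = j \<and> j = l \<and> l = m) + c))
      = x i * x j * x l * ((x i * a i) * of_bool (i = j \<and> j = l) - - (c * (\<Sum>m\<in>UNIV. x m)))" for i j l
  proof -
    have "x i * x j * x l * x m * (a i * of_bool (i = j \<and> j = l \<and> l = m) + c)
        = (if l = m then of_bool (i = j \<and> j = l) * (x i ^ 4 * a i) else 0) + c * (x i * x j * x l) * x m" for m
      by (auto simp: power4_eq_xxxx algebra_simps)
    hence "(\<Sum>m\<in>UNIV. x i * x j * x l * x m * (a i * of_bool (i = j \<and> j = l \<and> l = m) + c))
        = of_bool (i = j \<and> j = l) * (x i ^ 4 * a i) + c * (x i * x j * x l) * (\<Sum>m\<in>UNIV. x m)"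
      by (simp only: sum.distrib sum_distrib_left) simp
    thus ?thesis by (auto simp: power4_eq_xxxx algebra_simps)
  qed
  thus ?thesis
    by (simp only: sum_cubic_form) (simp add: eval_nat_numeral mult_ac)
qed

text \<open>
  By symmetry the off-diagonal part of a square is twice the part above the diagonal; this is the
  origin of the factor 2.
\<close>

lemma sum_strictly_upper:
  fixes x p :: "'i::{finite,linorder} \<Rightarrow> real"
  shows "(\<Sum>i\<in>UNIV. \<Sum>j\<in>UNIV. x i * x j * (2 / (p i * p j) * of_bool (i < j)))
    = (\<Sum>i\<in>UNIV. x i / p i)^2 - (\<Sum>i\<in>UNIV. (x i / p i)^2)"
proof -
  define y where "y i = x i / p i" for i
  have "(\<Sum>i\<in>UNIV. x i / p i)^2 = (\<Sum>i\<in>UNIV. \<Sum>j\<in>UNIV. y i * y j)"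
    by (simp add: y_def power2_eq_square sum_product)
  also have "\<dots> = (\<Sum>i\<in>UNIV. \<Sum>j\<in>UNIV. (if i = j then (y i)^2 else 0) + (of_bool (i < j) * (y i * y j) + of_bool (j < i) * (y j * y i)))"
    by (intro sum.cong refl) (auto simp: power2_eq_square)
  also have "\<dots> = (\<Sum>i\<in>UNIV. (y i)^2) + ((\<Sum>i\<in>UNIV. \<Sum>j\<in>UNIV. of_bool (i < j) * (y i * y j)) + (\<Sum>i\<in>UNIV. \<Sum>j\<in>UNIV. of_bool (j < i) * (y j * y i)))"
    by (simp add: sum.distrib)
  also have "(\<Sum>i\<in>UNIV. \<Sum>j\<in>UNIV. of_bool (j < i) * (y j * y i)) = (\<Sum>i\<in>UNIV. \<Sum>j\<in>UNIV. of_bool (i < j) * (y i * y j))"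
    by (rule sum.swap)
  also have "(\<Sum>i\<in>UNIV. \<Sum>j\<in>UNIV. of_bool (i < j) * (y i * y j)) + (\<Sum>i\<in>UNIV. \<Sum>j\<in>UNIV. of_bool (i < j) * (y i * y j))
      = (\<Sum>i\<in>UNIV. \<Sum>j\<in>UNIV. x i * x j * (2 / (p i * p j) * of_bool (i < j)))"
    by (simp add: y_def mult_ac flip: sum.distrib)
  finally show ?thesis by (simp add: y_def)
qed

lemma coeff_half_eq_sym: "coeff_half p x = sym_coeff_half p x"
proof -
  have "(\<Sum>i\<in>UNIV. ext_delta x i / ext_prob p i) = (\<Sum>i\<in>UNIV. x $ i * (1 / p $ i - 1 / rest p))"
    by (simp add: sum_option ext_delta_def ext_prob_def right_diff_distrib sum_subtractf sum_divide_distrib)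
  moreover have "(\<Sum>i\<in>UNIV. ext_delta x i * (ext_delta x i / ext_prob p i)^2)
      = (\<Sum>i\<in>UNIV. \<Sum>j\<in>UNIV. \<Sum>l\<in>UNIV. x $ i * x $ j * x $ l
              * (1 / (p $ i)^2 * of_bool (i = j \<and> j = l) - 1 / (rest p)^2))"
    unfolding sum_cubic_form
    by (simp add: sum_option ext_delta_def ext_prob_def power_divide power2_eq_square power3_eq_cube mult.assoc)
  ultimately show ?thesis unfolding coeff_half_def sym_coeff_half_def by simp
qed

lemma coeff_one_eq_sym: "coeff_one p x = sym_coeff_one p x"
proof -
  let ?T = "\<Sum>i\<in>UNIV. ext_delta x i * (ext_delta x i / ext_prob p i)^2"
  let ?S = "\<Sum>i\<in>UNIV. ext_delta x i / ext_prob p i"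
  let ?Q = "\<Sum>i\<in>UNIV. (ext_delta x i / ext_prob p i)^2"
  let ?F = "\<Sum>i\<in>UNIV. ext_delta x i * (ext_delta x i / ext_prob p i)^3"
  have T: "(\<Sum>i\<in>UNIV. \<Sum>j\<in>UNIV. \<Sum>l\<in>UNIV. x $ i * x $ j * x $ l
              * (1 / (p $ i)^2 * of_bool (i = j \<and> j = l) - 1 / (rest p)^2)) = ?T"
    unfolding sum_cubic_form
    by (simp add: sum_option ext_delta_def ext_prob_def power_divide power2_eq_square power3_eq_cube mult.assoc)
  have S: "(\<Sum>m\<in>UNIV. x $ m * (1 / p $ m - 1 / rest p)) = ?S"
    by (simp add: sum_option ext_delta_def ext_prob_def right_diff_distrib sum_subtractf sum_divide_distrib)
  have TS: "(\<Sum>i\<in>UNIV. \<Sum>j\<in>UNIV. \<Sum>l\<in>UNIV. \<Sum>m\<in>UNIV. x $ i * x $ j * x $ l * x $ m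
              * (1 / (p $ i)^2 * of_bool (i = j \<and> j = l) - 1 / (rest p)^2)
              * (1 / p $ m - 1 / rest p)) = ?T * ?S"
    unfolding T[symmetric] S[symmetric] sum_distrib_right unfolding sum_distrib_left
    by (intro sum.cong refl) (simp only: mult_ac)
  have F: "(\<Sum>i\<in>UNIV. \<Sum>j\<in>UNIV. \<Sum>l\<in>UNIV. \<Sum>m\<in>UNIV. x $ i * x $ j * x $ l * x $ m
              * (1 / (p $ i)^3 * of_bool (i = j \<and> j = l \<and> l = m) + 1 / (rest p)^3)) = ?F"
    unfolding sum_quartic_form
    by (simp add: sum_option ext_delta_def ext_prob_def power_divide eval_nat_numeral mult.assoc)
  have SQ: "(\<Sum>i\<in>UNIV. \<Sum>j\<in>UNIV. x $ i * x $ j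
              * (3 / (p $ i)^2 * of_bool (i = j) + 2 / (p $ i * p $ j) * of_bool (i < j)
                 - 2 / (p $ i * rest p) + 3 / (rest p)^2)) = ?S^2 + 2 * ?Q"
  proof -
    let ?y = "\<lambda>i. x $ i / p $ i"
    have "(\<Sum>i\<in>UNIV. \<Sum>j\<in>UNIV. x $ i * x $ j
              * (3 / (p $ i)^2 * of_bool (i = j) + 2 / (p $ i * p $ j) * of_bool (i < j)
                 - 2 / (p $ i * rest p) + 3 / (rest p)^2))
       = (\<Sum>i\<in>UNIV. \<Sum>j\<in>UNIV. (if i = j then 3 * (?y i)^2 else 0)
            + x $ i * x $ j * (2 / (p $ i * p $ j) * of_bool (i < j))
            - 2 / rest p * (?y i * x $ j) + 3 / (rest p)^2 * (x $ i * x $ j))"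
      by (intro sum.cong refl) (auto simp: power2_eq_square algebra_simps)
    also have "\<dots> = 3 * (\<Sum>i\<in>UNIV. (?y i)^2) + ((\<Sum>i\<in>UNIV. ?y i)^2 - (\<Sum>i\<in>UNIV. (?y i)^2))
        - 2 / rest p * ((\<Sum>i\<in>UNIV. ?y i) * (\<Sum>j\<in>UNIV. x $ j)) + 3 / (rest p)^2 * (\<Sum>j\<in>UNIV. x $ j)^2"
      unfolding sum_strictly_upper[symmetric] power2_eq_square[of "\<Sum>j\<in>UNIV. x $ j"] sum_product
      by (simp add: sum.distrib sum_subtractf sum_distrib_left)
    also have "\<dots> = ?S^2 + 2 * ?Q"
      by (simp add: sum_option ext_delta_def ext_prob_def power2_eq_square algebra_simps)
    finally show ?thesis .
  qed
  have inv: "(\<Sum>i\<in>UNIV. 1 / ext_prob p i) = (\<Sum>i\<in>UNIV. 1 / p $ i) + 1 / rest p"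
    by (simp add: sum_option ext_prob_def)
  show ?thesis
    unfolding coeff_one_def sym_coeff_one_def TS F T SQ inv by (simp add: power2_eq_square algebra_simps)
qed

lemma expansion_eq_sym: "expansion N p k = sym_expansion N p k"
  by (simp add: expansion_def sym_expansion_def coeff_half_eq_sym coeff_one_eq_sym)

section \<open>The Gaussian quadratic form\<close>

lemma matrix_inv_unique:
  fixes A B :: "real^'n^'n"
  assumes "A ** B = mat 1"
  shows "matrix_inv A = B"
proof -
  have BA: "B ** A = mat 1" using assms by (simp add: matrix_left_right_inverse)
  have "A ** matrix_inv A = mat 1"
    unfolding matrix_inv_def by (rule someI2[of _ B]) (use assms BA in auto)
  hence "B ** (A ** matrix_inv A) = B" by simp
  thus ?thesis by (simp add: matrix_mul_assoc BA)
qed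

text \<open>
  The covariance matrix is a rank one perturbation of a diagonal matrix, so its inverse is one as well
  (the Sherman--Morrison formula).
\<close>

lemma Sigma_mat_inverse:
  fixes p :: "real^'n"
  assumes p: "\<And>i. 0 < p $ i" and q: "0 < rest p"
  shows "matrix_inv (Sigma_mat p) = (\<chi> i j. (if i = j then 1 / p $ i else 0) + 1 / rest p)"
proof (rule matrix_inv_unique)
  have sum_p: "(\<Sum>i\<in>UNIV. p $ i) = 1 - rest p"
    using p by (simp add: rest_def l1_norm_def less_imp_le abs_of_pos)
  have "(\<Sum>k\<in>UNIV. ((if i = k then p $ i else 0) - p $ i * p $ k) * ((if k = j then 1 / p $ k else 0) + 1 / rest p))
      = (if i = j then 1 else 0)" for i j
  proof -
    have pj: "p $ j \<noteq> 0" "p $ i \<noteq> 0" using p[of j] p[of i] by auto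
    have "((if i = k then p $ i else 0) - p $ i * p $ k) * ((if k = j then 1 / p $ k else 0) + 1 / rest p)
       = (if k = j then (if i = j then 1 else 0) - p $ i else 0)
         + ((if i = k then p $ i / rest p else 0) - p $ i / rest p * p $ k)" for k
      using pj by (auto simp: algebra_simps)
    hence "(\<Sum>k\<in>UNIV. ((if i = k then p $ i else 0) - p $ i * p $ k) * ((if k = j then 1 / p $ k else 0) + 1 / rest p))
        = (if i = j then 1 else 0) - p $ i + (p $ i / rest p - p $ i / rest p * (1 - rest p))"
      by (simp add: sum.distrib sum_subtractf sum_p flip: sum_distrib_left sum_divide_distrib)
    thus ?thesis using q by (simp add: field_simps)
  qed
  thus "Sigma_mat p ** (\<chi> i j. (if i = j then 1 / p $ i else 0) + 1 / rest p) = mat 1"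
    by (simp add: Sigma_mat_def matrix_matrix_mult_def mat_def vec_eq_iff)
qed

text \<open>
  The rank one part of the inverse is the contribution of the extra category \<open>None\<close>. This makes the
  quadratic form the sum of the quadratic forms of the Poisson approximations of all categories.
\<close>

lemma Sigma_mat_quadratic_form:
  fixes p x :: "real^'n"
  assumes p: "\<And>i. 0 < p $ i" and q: "0 < rest p"
  shows "x \<bullet> (matrix_inv (Sigma_mat p) *v x) = (\<Sum>i\<in>UNIV. (ext_delta x i)^2 / ext_prob p i)"
proof -
  have "(\<Sum>j\<in>UNIV. ((if i = j then 1 / p $ i else 0) + 1 / rest p) * x $ j)
      = x $ i / p $ i + (\<Sum>j\<in>UNIV. x $ j) / rest p" for i
  proof -
    have "((if i = j then 1 / p $ i else 0) + 1 / rest p) * x $ j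
       = (if i = j then x $ i / p $ i else 0) + x $ j / rest p" for j by (auto simp: distrib_right)
    thus ?thesis by (simp add: sum.distrib sum_divide_distrib)
  qed
  hence "x \<bullet> (matrix_inv (Sigma_mat p) *v x)
      = (\<Sum>i\<in>UNIV. x $ i * (x $ i / p $ i + (\<Sum>j\<in>UNIV. x $ j) / rest p))"
    unfolding Sigma_mat_inverse[OF assms] by (simp add: inner_vec_def matrix_vector_mult_def)
  also have "\<dots> = (\<Sum>i\<in>UNIV. (x $ i)^2 / p $ i) + (\<Sum>j\<in>UNIV. x $ j)^2 / rest p"
    by (simp add: distrib_left sum.distrib power2_eq_square flip: sum_distrib_right sum_divide_distrib)
  finally show ?thesis by (simp add: sum_option ext_delta_def ext_prob_def)
qed

section \<open>The multinomial distribution\<close>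

definition ext_count :: "nat \<Rightarrow> nat^'d \<Rightarrow> 'd option \<Rightarrow> nat" where
  "ext_count N k i = (case i of None \<Rightarrow> N - total k | Some j \<Rightarrow> k $ j)"

lemma sum_ext_prob:
  assumes "\<And>i. 0 < p $ i"
  shows "(\<Sum>i\<in>UNIV. ext_prob p i) = 1"
  using assms by (simp add: sum_option ext_prob_def rest_def l1_norm_def less_imp_le abs_of_pos)

lemma ext_prob_pos:
  assumes "\<And>i. 0 < p $ i" "0 < rest p"
  shows "0 < ext_prob p i"
  using assms by (simp add: ext_prob_def split: option.split)

lemma ext_count_eq:
  fixes p :: "real^'d"
  assumes p: "\<And>i. 0 < p $ i" and N: "1 \<le> N" and k: "total k \<le> N"
  shows "real (ext_count N k i) = real N * ext_prob p i + sqrt (real N) * ext_delta (delta_vec N p k) i"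
proof -
  have Some: "real (k $ j) = real N * p $ j + sqrt (real N) * delta_vec N p k $ j" for j
    using N by (simp add: delta_vec_def delta_def)
  have sum_p: "(\<Sum>j\<in>UNIV. p $ j) = 1 - rest p"
    using sum_ext_prob[OF p] by (simp add: sum_option ext_prob_def)
  have "real (total k) = (\<Sum>j\<in>UNIV. real N * p $ j + sqrt (real N) * delta_vec N p k $ j)"
    by (simp add: total_def Some)
  also have "\<dots> = real N * (1 - rest p) + sqrt (real N) * (\<Sum>j\<in>UNIV. delta_vec N p k $ j)"
    by (simp only: sum.distrib sum_p flip: sum_distrib_left)
  finally have "real (N - total k) = real N * rest p - sqrt (real N) * (\<Sum>j\<in>UNIV. delta_vec N p k $ j)"
    using k by (simp add: of_nat_diff algebra_simps)
  thus ?thesis using Some by (simp add: ext_count_def ext_prob_def ext_delta_def split: option.split)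
qed

text \<open>
  The multinomial distribution is the distribution of independent Poisson(\<open>N * P i\<close>) counts
  conditioned on their sum being \<open>N\<close>, and the same relation holds between the normal densities that
  approximate these laws. Hence the ratio in question is the product of the Poisson ratios over all
  categories, divided by the one for the sum.
\<close>

lemma multinomial_ratio_eq:
  fixes p :: "real^'d" and k :: "nat^'d"
  assumes p: "\<And>i. 0 < p $ i" and q: "0 < rest p" and N: "1 \<le> N" and k: "total k \<le> N"
  defines "x \<equiv> delta_vec N p k"
  shows "multinomial_prob N p k / (real N powr (- real CARD('d) / 2) * phi_Sigma p x)
    = exp ((\<Sum>i\<in>UNIV. poisson_log (real N * ext_prob p i) (ext_count N k i)) - poisson_log (real N) N)"
    (is "?r = exp ?L")
proof -
  let ?P = "ext_prob p" and ?K = "ext_count N k" and ?d = "real CARD('d)"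
  have P: "0 < ?P i" for i by (rule ext_prob_pos[OF p q])
  have sumK: "(\<Sum>i\<in>UNIV. real (?K i)) = real N"
    using k by (simp add: sum_option ext_count_def total_def of_nat_diff)
  define F where "F = (\<Sum>i\<in>UNIV. ln (fact (?K i) :: real))"
  define G where "G = (\<Sum>i\<in>UNIV. ln (?P i))"
  define H where "H = (\<Sum>i\<in>UNIV. real (?K i) * ln (?P i))"
  define Q where "Q = (\<Sum>i\<in>UNIV. (ext_delta x i)^2 / ?P i)"
  have mult: "multinomial_prob N p k = fact N / (\<Prod>i\<in>UNIV. fact (?K i)) * (\<Prod>i\<in>UNIV. ?P i ^ ?K i)"
    using k by (simp add: multinomial_prob_def prod_option ext_count_def ext_prob_def mult_ac)
  have prods: "0 < (\<Prod>i\<in>UNIV. fact (?K i) :: real)" "0 < (\<Prod>i\<in>UNIV. ?P i ^ ?K i)" "0 < (\<Prod>i\<in>UNIV. ?P i)"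
    using P by (auto intro!: prod_pos)
  have ln_multinomial: "ln (multinomial_prob N p k) = ln (fact N) - F + H"
    using prods P unfolding mult F_def H_def
    by (simp add: ln_mult ln_div ln_prod ln_realpow less_imp_neq[OF P, symmetric])
  have phi: "phi_Sigma p x = 1 / sqrt ((2 * pi) ^ CARD('d) * (\<Prod>i\<in>UNIV. ?P i)) * exp (- (1/2) * Q)"
    unfolding phi_Sigma_def Sigma_mat_quadratic_form[OF p q] Q_def
    by (simp add: prod_option ext_prob_def mult_ac)
  have ln_phi: "ln (phi_Sigma p x) = - (?d * ln (2 * pi) + G) / 2 - Q / 2"
    using prods P unfolding phi G_def
    by (simp add: ln_mult ln_div ln_sqrt ln_realpow ln_prod less_imp_neq[OF P, symmetric] diff_divide_distrib add_divide_distrib distrib_left)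
  have "0 < multinomial_prob N p k"
    unfolding mult using prods by (intro mult_pos_pos divide_pos_pos) auto
  moreover have "0 < phi_Sigma p x"
    unfolding phi using prods by (intro mult_pos_pos divide_pos_pos) auto
  moreover have "0 < real N powr (- ?d / 2)" using N by simp
  ultimately have pos: "0 < multinomial_prob N p k" "0 < phi_Sigma p x" "0 < real N powr (- ?d / 2)" .
  have ln_N: "ln (real N powr (- ?d / 2)) = - ?d / 2 * ln (real N)" using N by (simp add: ln_powr)
  have "ln ?r = ln (multinomial_prob N p k) - (ln (real N powr (- ?d / 2)) + ln (phi_Sigma p x))"
    using ln_div[of "multinomial_prob N p k" "real N powr (- ?d / 2) * phi_Sigma p x"]
      ln_mult[of "real N powr (- ?d / 2)" "phi_Sigma p x"] pos by simp
  hence ln_r: "ln ?r = ln (fact N) - F + H + ?d / 2 * ln (real N) + (?d * ln (2 * pi) + G) / 2 + Q / 2"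
    unfolding ln_multinomial ln_N ln_phi by linarith
  have category: "poisson_log (real N * ?P i) (?K i) = ln (real N) * real (?K i) + real (?K i) * ln (?P i) - real N * ?P i
      - ln (fact (?K i)) + (ln (2 * pi * real N) + ln (?P i)) / 2 + ((ext_delta x i)^2 / ?P i) / 2" for i
  proof -
    have "real (?K i) - real N * ?P i = sqrt (real N) * ext_delta x i"
      unfolding ext_count_eq[OF p N k] x_def by simp
    hence "(real (?K i) - real N * ?P i)^2 / (2 * (real N * ?P i)) = (real N * (ext_delta x i)^2) / (real N * (2 * ?P i))"
      by (simp add: power_mult_distrib mult_ac)
    also have "\<dots> = (ext_delta x i)^2 / ?P i / 2" using N by (subst mult_divide_mult_cancel_left) auto
    finally have square: "(real (?K i) - real N * ?P i)^2 / (2 * (real N * ?P i)) = (ext_delta x i)^2 / ?P i / 2" .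
    have ln_rate: "ln (real N * ?P i) = ln (real N) + ln (?P i)"
      "ln (2 * pi * (real N * ?P i)) = ln (2 * pi * real N) + ln (?P i)"
      using P[of i] N by (simp_all add: ln_mult)
    show ?thesis unfolding poisson_log_def square ln_rate by (simp add: distrib_left)
  qed
  have "(\<Sum>i\<in>UNIV. poisson_log (real N * ?P i) (?K i))
      = ln (real N) * real N + H - real N - F + ((?d + 1) * ln (2 * pi * real N) + G) / 2 + Q / 2"
  proof -
    have "(\<Sum>i\<in>UNIV. poisson_log (real N * ?P i) (?K i))
        = ln (real N) * (\<Sum>i\<in>UNIV. real (?K i)) + H - real N * (\<Sum>i\<in>UNIV. ?P i) - F
          + ((\<Sum>i\<in>(UNIV :: 'd option set). ln (2 * pi * real N)) + G) / 2 + Q / 2"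
      unfolding category H_def F_def G_def Q_def
      by (simp only: sum.distrib sum_subtractf sum_distrib_left sum_divide_distrib[symmetric])
    thus ?thesis unfolding sumK sum_ext_prob[OF p] by (simp add: sum_option algebra_simps)
  qed
  moreover have "poisson_log (real N) N = real N * ln (real N) - real N - ln (fact N) + ln (2 * pi * real N) / 2"
    by (simp add: poisson_log_def)
  ultimately have "ln ?r = ?L"
    unfolding ln_r using N by (simp add: ln_mult field_simps)
  moreover have "0 < ?r" using pos by simp
  ultimately show ?thesis by (metis exp_ln)
qed

lemma sym_expansion_category:
  fixes p :: "real^'d" and k :: "nat^'d"
  assumes N: "1 \<le> N"
  defines "x \<equiv> delta_vec N p k"
  shows "sym_expansion N p k = category_expansion N (ext_prob p) (ext_delta x)"
proof -
  have e1: "real N powr (- 1/2) = 1 / sqrt (real N)"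
    by (simp add: powr_minus powr_half_sqrt field_simps)
  have e2: "real N powr (- 1) = (1 / sqrt (real N))^2"
    using N by (simp add: powr_minus power_divide field_simps)
  have half: "sym_coeff_half p x = (\<Sum>i\<in>UNIV. category_half (ext_prob p i) (ext_delta x i))"
    by (simp add: sym_coeff_half_def category_half_def sum_subtractf sum_divide_distrib)
  have one: "sym_coeff_one p x = (\<Sum>i\<in>UNIV. category_half (ext_prob p i) (ext_delta x i))^2 / 2
                     + ((\<Sum>i\<in>UNIV. category_one (ext_prob p i) (ext_delta x i)) + 1 / 12)"
  proof -
    have "(\<Sum>i\<in>UNIV. category_one (ext_prob p i) (ext_delta x i))
       = (\<Sum>i\<in>UNIV. (ext_delta x i / ext_prob p i)^2) / 4
         - (\<Sum>i\<in>UNIV. ext_delta x i * (ext_delta x i / ext_prob p i)^3) / 12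
         - (\<Sum>i\<in>UNIV. 1 / ext_prob p i) / 12"
      by (simp add: category_one_def sum_subtractf sum_divide_distrib mult.commute)
    moreover have "sym_coeff_one p x = (sym_coeff_half p x)^2 / 2
       + ((\<Sum>i\<in>UNIV. (ext_delta x i / ext_prob p i)^2) / 4
         - (\<Sum>i\<in>UNIV. ext_delta x i * (ext_delta x i / ext_prob p i)^3) / 12
         - (\<Sum>i\<in>UNIV. 1 / ext_prob p i) / 12 + 1 / 12)"
      unfolding sym_coeff_one_def sym_coeff_half_def by (simp add: field_simps)
    ultimately show ?thesis by (simp only: half)
  qed
  show ?thesis unfolding sym_expansion_def category_expansion_def x_def[symmetric] e1 e2 half one ..
qed

text \<open>
  The first bound follows from \<open>N powr (- 1/3) \<le> 1\<close> and, for \<open>i = None\<close>, implies that \<open>N - total k\<close> is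
  positive. The last bound is what the exponent \<open>- 1/3\<close> is made for: it gives
  \<open>l1_norm x \<le> N powr (1/6)\<close>, so the cube is at most of the order of \<open>sqrt N\<close>.
\<close>

lemma bulk_bounds:
  fixes p :: "real^'d"
  assumes p: "\<And>i. 0 < p $ i" and q: "0 < rest p" and \<eta>: "0 < \<eta>" "\<eta> < 1" and N: "1 \<le> N" and k: "k \<in> bulk p \<eta> N"
  defines "x \<equiv> delta_vec N p k"
  shows "\<bar>ext_delta x i\<bar> \<le> \<eta> * (sqrt (real N) * ext_prob p i)"
    and "total k \<le> N"
    and "\<bar>ext_delta x i\<bar> \<le> 1 + l1_norm x"
    and "(1 + l1_norm x)^3 \<le> 8 * sqrt (real N)"
proof -
  have sN: "0 < sqrt (real N)" using N by simp
  have Some: "\<bar>x $ j\<bar> \<le> \<eta> * real N powr (- 1/3) * (sqrt (real N) * p $ j)" for j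
  proof -
    have "\<bar>x $ j / (sqrt (real N) * p $ j)\<bar> \<le> \<eta> * real N powr (- 1/3)"
      using k unfolding bulk_def x_def delta_vec_def by simp
    thus ?thesis using sN p[of j] by (simp add: abs_mult pos_divide_le_eq)
  qed
  have None: "\<bar>\<Sum>j\<in>UNIV. x $ j\<bar> \<le> \<eta> * real N powr (- 1/3) * (sqrt (real N) * rest p)"
  proof -
    have "\<bar>(\<Sum>j\<in>UNIV. x $ j / (sqrt (real N) * rest p))\<bar> \<le> \<eta> * real N powr (- 1/3)"
      using k unfolding bulk_def x_def delta_vec_def by simp
    hence "\<bar>(\<Sum>j\<in>UNIV. x $ j) / (sqrt (real N) * rest p)\<bar> \<le> \<eta> * real N powr (- 1/3)"
      by (simp only: sum_divide_distrib)
    thus ?thesis using sN q by (simp add: abs_mult pos_divide_le_eq)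
  qed
  have "real N powr (- 1/3) \<le> real N powr 0" using N by (intro powr_mono) auto
  hence shrink: "\<eta> * real N powr (- 1/3) * (sqrt (real N) * P) \<le> \<eta> * (sqrt (real N) * P)" if "0 < P" for P
    using that \<eta> N sN by (simp add: mult_le_cancel_left1 mult_right_mono)
  show bound: "\<bar>ext_delta x i\<bar> \<le> \<eta> * (sqrt (real N) * ext_prob p i)" for i
  proof (cases i)
    case None
    thus ?thesis using order.trans[OF \<open>\<bar>\<Sum>j\<in>UNIV. x $ j\<bar> \<le> _\<close> shrink[OF q]]
      by (simp add: ext_delta_def ext_prob_def)
  next
    case (Some j)
    thus ?thesis using order.trans[OF \<open>\<And>j. \<bar>x $ j\<bar> \<le> _ j\<close>[of j] shrink[OF p[of j]]]
      by (simp add: ext_delta_def ext_prob_def)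
  qed
  have sum_p: "(\<Sum>j\<in>UNIV. p $ j) = 1 - rest p"
    using sum_ext_prob[OF p] by (simp add: sum_option ext_prob_def)
  show "total k \<le> N"
  proof -
    have "real (k $ j) = real N * p $ j + sqrt (real N) * x $ j" for j
      using N by (simp add: x_def delta_vec_def delta_def)
    hence "real (total k) = real N * (1 - rest p) + sqrt (real N) * (\<Sum>j\<in>UNIV. x $ j)"
      by (simp add: total_def sum.distrib flip: sum_distrib_left sum_p)
    moreover have "sqrt (real N) * (\<Sum>j\<in>UNIV. x $ j) \<le> sqrt (real N) * (1 * (sqrt (real N) * rest p))"
    proof -
      have "\<eta> * (sqrt (real N) * rest p) \<le> 1 * (sqrt (real N) * rest p)" using \<eta> sN q by (intro mult_right_mono) auto
      moreover have "(\<Sum>j\<in>UNIV. x $ j) \<le> \<eta> * (sqrt (real N) * rest p)"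
        using bound[of None] by (simp add: ext_delta_def ext_prob_def abs_le_iff)
      ultimately show ?thesis using sN by (intro mult_left_mono) linarith+
    qed
    moreover have "sqrt (real N) * (1 * (sqrt (real N) * rest p)) = real N * rest p" by simp
    ultimately have "real (total k) \<le> real N" by (simp add: algebra_simps)
    thus ?thesis by simp
  qed
  show "\<bar>ext_delta x i\<bar> \<le> 1 + l1_norm x"
  proof (cases i)
    case None
    have "\<bar>\<Sum>j\<in>UNIV. x $ j\<bar> \<le> l1_norm x" unfolding l1_norm_def by (rule sum_abs)
    thus ?thesis using None by (simp add: ext_delta_def)
  next
    case (Some j)
    have "\<bar>x $ j\<bar> \<le> l1_norm x" unfolding l1_norm_def by (rule member_le_sum) auto
    thus ?thesis using Some by (simp add: ext_delta_def)
  qed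
  show "(1 + l1_norm x)^3 \<le> 8 * sqrt (real N)"
  proof -
    let ?s = "real N powr (1/6)"
    have s1: "1 \<le> ?s" using N by (simp add: ge_one_powr_ge_zero)
    have "l1_norm x \<le> (\<Sum>j\<in>UNIV. \<eta> * real N powr (- 1/3) * (sqrt (real N) * p $ j))"
      unfolding l1_norm_def by (intro sum_mono Some)
    also have "\<dots> = \<eta> * (real N powr (- 1/3) * sqrt (real N)) * (1 - rest p)"
      by (simp add: mult.assoc flip: sum_distrib_left sum_p)
    also have "real N powr (- 1/3) * sqrt (real N) = ?s"
      by (simp add: powr_half_sqrt[symmetric] powr_add[symmetric])
    also have "\<eta> * ?s * (1 - rest p) \<le> 1 * ?s * 1"
      using \<eta> q s1 sum_p sum_nonneg[of UNIV "\<lambda>j. p $ j"] p by (intro mult_mono) (auto simp: less_imp_le)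
    finally have "1 + l1_norm x \<le> 2 * ?s" using s1 by simp
    moreover have "0 \<le> l1_norm x" unfolding l1_norm_def by (rule sum_nonneg) simp
    ultimately have "(1 + l1_norm x)^3 \<le> (2 * ?s)^3" by (intro power_mono) auto
    also have "\<dots> = 8 * ?s powr 3" using N by (simp add: power_mult_distrib powr_numeral)
    also have "?s powr 3 = sqrt (real N)" by (simp add: powr_powr powr_half_sqrt)
    finally show ?thesis .
  qed
qed

text \<open>
  The limes superior is at most \<open>\<bar>C\<bar>\<close>; passing to \<open>\<bar>C\<bar> + 1\<close> gives the bound that is strict and positive,
  as the definition demands.
\<close>

lemma bigo_uniformlyI:
  assumes "\<And>N k. 1 \<le> N \<Longrightarrow> k \<in> B N \<Longrightarrow> \<bar>u N k\<bar> \<le> C * v N k"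
    and "\<And>N k. 1 \<le> N \<Longrightarrow> k \<in> B N \<Longrightarrow> 0 < v N k"
  shows "bigo_uniformly B u v"
proof -
  have "(SUP k\<in>B N. ereal \<bar>u N k / v N k\<bar>) \<le> ereal \<bar>C\<bar>" if "1 \<le> N" for N
  proof (rule SUP_least)
    fix k assume k: "k \<in> B N"
    have v: "0 < v N k" using assms(2)[OF that k] .
    have "\<bar>u N k / v N k\<bar> \<le> C" using assms(1)[OF that k] v by (simp add: abs_divide pos_divide_le_eq)
    thus "ereal \<bar>u N k / v N k\<bar> \<le> ereal \<bar>C\<bar>" by simp
  qed
  hence "\<forall>\<^sub>F N in sequentially. (SUP k\<in>B N. ereal \<bar>u N k / v N k\<bar>) \<le> ereal \<bar>C\<bar>"
    by (intro eventually_sequentiallyI[of 1])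
  hence "limsup (\<lambda>N. SUP k\<in>B N. ereal \<bar>u N k / v N k\<bar>) \<le> ereal \<bar>C\<bar>" by (rule Limsup_bounded)
  also have "\<dots> < ereal (\<bar>C\<bar> + 1)" by simp
  finally show ?thesis unfolding bigo_uniformly_def by (intro exI[of _ "\<bar>C\<bar> + 1"]) auto
qed

lemma multinomial_sym_expansion:
  fixes p :: "real^'d"
  assumes p: "\<And>i. 0 < p $ i" and q: "0 < rest p" and \<eta>: "0 < \<eta>" "\<eta> < 1"
  shows "bigo_uniformly (bulk p \<eta>)
           (\<lambda>N k. multinomial_prob N p k
                    / (real N powr (- real CARD('d) / 2) * phi_Sigma p (delta_vec N p k))
                  - sym_expansion N p k)
           (\<lambda>N k. (1 + l1_norm (delta_vec N p k)) ^ 9 / real N powr (3/2))"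
proof (rule conditioned_poisson_expansion[of "ext_prob p" \<eta>])
  show "0 < ext_prob p i" for i by (rule ext_prob_pos[OF p q])
  show "0 \<le> \<eta>" "\<eta> < 1" using \<eta> by simp_all
next
  fix C
  assume C:
    "\<And>(N::nat) K x w. 1 \<le> N \<Longrightarrow> (\<And>i. real (K i) = real N * ext_prob p i + sqrt (real N) * x i)
      \<Longrightarrow> (\<And>i. \<bar>x i\<bar> \<le> \<eta> * (sqrt (real N) * ext_prob p i)) \<Longrightarrow> (\<And>i. \<bar>x i\<bar> \<le> w) \<Longrightarrow> 1 \<le> w
      \<Longrightarrow> w^3 \<le> 8 * sqrt (real N)
      \<Longrightarrow> \<bar>exp ((\<Sum>i\<in>UNIV. poisson_log (real N * ext_prob p i) (K i)) - poisson_log (real N) N)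
           - category_expansion N (ext_prob p) x\<bar>
         \<le> C * (w^9 * (1 / sqrt (real N))^3)"
  show ?thesis
  proof (rule bigo_uniformlyI[where C = C])
    fix N and k :: "nat^'d" assume N: "1 \<le> N" and k: "k \<in> bulk p \<eta> N"
    define x where "x = delta_vec N p k"
    note bounds = bulk_bounds[OF p q \<eta> N k, folded x_def]
    have w: "1 \<le> 1 + l1_norm x" by (simp add: l1_norm_def sum_nonneg)
    have "sqrt (real N) ^ 3 = (real N powr (1/2)) powr 3"
      using N by (simp add: powr_half_sqrt powr_numeral)
    also have "\<dots> = real N powr (3/2)" by (simp add: powr_powr)
    finally have scale: "(1 / sqrt (real N))^3 = 1 / real N powr (3/2)"
      by (simp add: power_divide)
    show "\<bar>multinomial_prob N p k / (real N powr (- real CARD('d) / 2) * phi_Sigma p (delta_vec N p k))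
           - sym_expansion N p k\<bar> \<le> C * ((1 + l1_norm (delta_vec N p k)) ^ 9 / real N powr (3/2))"
      using C[OF N ext_count_eq[OF p N bounds(2), folded x_def] bounds(1) bounds(3) w bounds(4)]
      unfolding x_def[symmetric] multinomial_ratio_eq[OF p q N bounds(2), folded x_def]
        sym_expansion_category[OF N, of p k, folded x_def] scale
      by simp
    show "0 < (1 + l1_norm (delta_vec N p k)) ^ 9 / real N powr (3/2)"
      using N w unfolding x_def by (intro divide_pos_pos zero_less_power) auto
  qed
qed

theorem theorem2p1:
  fixes p :: "real^('d::{finite,linorder})" and \<eta> :: real
  assumes "\<forall>i. 0 < p $ i \<and> p $ i < 1"
    and "l1_norm p < 1"
    and "0 < \<eta>" and "\<eta> < 1"
  shows "bigo_uniformly (bulk p \<eta>)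
           (\<lambda>N k. multinomial_prob N p k
                    / (real N powr (- real CARD('d) / 2) * phi_Sigma p (delta_vec N p k))
                  - expansion N p k)
           (\<lambda>N k. (1 + l1_norm (delta_vec N p k)) ^ 9 / real N powr (3/2))
       \<and> bigo_uniformly (bulk p \<eta>)
           (\<lambda>N k. multinomial_prob N p k
                    / (real N powr (- real CARD('d) / 2) * phi_Sigma p (delta_vec N p k))
                  - sym_expansion N p k)
           (\<lambda>N k. (1 + l1_norm (delta_vec N p k)) ^ 9 / real N powr (3/2))
       \<and> (\<forall>N\<ge>1. \<forall>k\<in>bulk p \<eta> N. expansion N p k = sym_expansion N p k)"
proof -
  have "\<And>i. 0 < p $ i" and "0 < rest p" using assms by (auto simp: rest_def)
  from multinomial_sym_expansion[OF this assms(3,4)] show ?thesis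
    by (simp add: expansion_eq_sym)
qed

end
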